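(* For every fixed $\lambda$ with $0<\lambda<1$ there are constants $c(\lambda)>0$ and $C(\lambda)>0$ (independent of $d$) such that, for $I$ chosen from $\mathcal{I}(Q_d)$ according to ${\rm hc}(\lambda)$, a.a.s. $$c(\lambda)\left(\frac{2}{1+\lambda}\right)^d\le\min\{|I\cap\mathcal{E}|,|I\cap\mathcal{O}|\}\le C(\lambda)\left(\frac{2}{1+\lambda}\right)^d.$$
   Context: $Q_d$ is the discrete hypercube: the graph on vertex set $\{0,1\}^d$ in which two strings are adjacent iff they differ in exactly one coordinate. It is bipartite with classes $\mathcal{E}$ (strings with an even number of $1$'s) and $\mathcal{O}$ (strings with an odd number of $1$'s). $\mathcal{I}(Q_d)$ is the set of independent sets of $Q_d$ (including the empty set). For $\lambda>0$, the hard-core distribution ${\rm hc}(\lambda)$ on $\mathcal{I}(Q_d)$ chooses each $I$ with probability proportional to $\lambda^{|I|}$. An event holds asymptotically almost surely (a.a.s.) if its probability tends to $1$ as $d\to\infty$. *)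

theory Defs
  imports "HOL-Probability.Probability"
begin

text \<open>A finite graph is given by its vertex set \<open>V\<close> and a symmetric irreflexive adjacency
  relation \<open>adj\<close>.\<close>

definition indep_sets_of :: "'a set \<Rightarrow> ('a \<Rightarrow> 'a \<Rightarrow> bool) \<Rightarrow> 'a set set" where
  "indep_sets_of V adj = {I. I \<subseteq> V \<and> (\<forall>x\<in>I. \<forall>y\<in>I. \<not> adj x y)}"

definition hard_core :: "'a set \<Rightarrow> ('a \<Rightarrow> 'a \<Rightarrow> bool) \<Rightarrow> real \<Rightarrow> 'a set pmf" where
  "hard_core V adj lam = embed_pmf (\<lambda>I.
     if I \<in> indep_sets_of V adj
     then lam ^ card I / (\<Sum>J\<in>indep_sets_of V adj. lam ^ card J) else 0)"

lemma finite_indep_sets_of: "finite V \<Longrightarrow> finite (indep_sets_of V adj)"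
  by (rule finite_subset[of _ "Pow V"]) (auto simp: indep_sets_of_def)

lemma empty_in_indep_sets_of: "{} \<in> indep_sets_of V adj"
  by (simp add: indep_sets_of_def)

text \<open>\<open>embed_pmf\<close> is only meaningful for a function that is a probability mass function; this
  is the case here.\<close>

lemma pmf_hard_core:
  assumes "finite V" "lam > 0"
  shows "pmf (hard_core V adj lam) I =
    (if I \<in> indep_sets_of V adj
     then lam ^ card I / (\<Sum>J\<in>indep_sets_of V adj. lam ^ card J) else 0)"
proof -
  let ?S = "indep_sets_of V adj"
  define Z where "Z = (\<Sum>J\<in>?S. lam ^ card J)"
  define f where "f = (\<lambda>I. if I \<in> ?S then lam ^ card I / Z else 0)"
  have fin: "finite ?S" using assms by (simp add: finite_indep_sets_of)
  have Z: "Z > 0" unfolding Z_def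
    using fin assms empty_in_indep_sets_of[of V adj] by (intro sum_pos) auto
  have nn: "f J \<ge> 0" for J
    using Z assms by (simp add: f_def)
  have "(\<integral>\<^sup>+ J. ennreal (f J) \<partial>count_space UNIV) = (\<Sum>J\<in>?S. ennreal (f J))"
    using fin by (intro nn_integral_count_space') (auto simp: f_def)
  also have "\<dots> = ennreal (\<Sum>J\<in>?S. f J)"
    by (rule sum_ennreal) (rule nn)
  also have "(\<Sum>J\<in>?S. f J) = (\<Sum>J\<in>?S. lam ^ card J) / Z"
    by (simp add: f_def sum_divide_distrib)
  also have "\<dots> = 1" using Z by (simp add: Z_def)
  finally have one: "(\<integral>\<^sup>+ J. ennreal (f J) \<partial>count_space UNIV) = 1" by simp
  have "pmf (embed_pmf f) I = f I"
    by (rule pmf_embed_pmf[OF nn one])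
  then show ?thesis unfolding hard_core_def f_def Z_def .
qed

text \<open>Strings in \<open>{0,1}\<^sup>d\<close> are Boolean lists of length \<open>d\<close>, with \<open>True\<close> in the role of \<open>1\<close>.\<close>

definition cube_verts :: "nat \<Rightarrow> bool list set" where
  "cube_verts d = {x. length x = d}"

definition cube_adj :: "nat \<Rightarrow> bool list \<Rightarrow> bool list \<Rightarrow> bool" where
  "cube_adj d x y \<longleftrightarrow>
     x \<in> cube_verts d \<and> y \<in> cube_verts d \<and> (\<exists>!i. i < d \<and> x ! i \<noteq> y ! i)"

definition cube_even :: "nat \<Rightarrow> bool list set" where
  "cube_even d = {x \<in> cube_verts d. even (count_list x True)}"

definition cube_odd :: "nat \<Rightarrow> bool list set" where
  "cube_odd d = {x \<in> cube_verts d. odd (count_list x True)}"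

lemma finite_cube_verts: "finite (cube_verts d)"
  using finite_lists_length_eq[of "UNIV :: bool set" d] by (simp add: cube_verts_def)

abbreviation cube_hard_core :: "nat \<Rightarrow> real \<Rightarrow> bool list set pmf" where
  "cube_hard_core d lam \<equiv> hard_core (cube_verts d) (cube_adj d) lam"

end

theory Submission
  imports Defs "HOL-Real_Asymp.Real_Asymp"
begin

text \<open>Write \<open>A\<close>, \<open>B\<close> for the even and odd parts of the random set, \<open>N = 2\<^sup>d\<^sup>-\<^sup>1\<close>, and
  \<open>m = N / (1 + \<lambda>)\<^sup>d\<close>, which is half of \<open>(2 / (1 + \<lambda>))\<^sup>d\<close>.

  Lower bound: given \<open>A\<close>, the set \<open>B\<close> is a random subset with density \<open>\<lambda> / (1 + \<lambda>)\<close> of the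
  odd vertices without neighbour in \<open>A\<close>, so every even vertex has no neighbour in \<open>B\<close> with
  probability at least \<open>(1 + \<lambda>)\<^sup>-\<^sup>d\<close>; a variance bound yields at least \<open>m / 2\<close> such vertices. Given
  \<open>B\<close>, each of them belongs to \<open>A\<close> independently with probability \<open>\<lambda> / (1 + \<lambda>)\<close>.

  Upper bound: one of the two parts, say \<open>A\<close>, has a closure (the vertices all of whose neighbours
  are neighbours of \<open>A\<close>) of size at most \<open>N / 2\<close>. A set \<open>S\<close> is a union of 2-linked components of
  \<open>A\<close> with probability at most \<open>\<lambda>\<^bsup>|S|\<^esup> (1 + \<lambda>)\<^bsup>-|N(S)|\<^esup>\<close>. Summing this, the number of isolated
  vertices of \<open>A\<close> is \<open>O(m)\<close>, and the components of size between 2 and \<open>d / 2\<close> are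
  negligible since they expand by a factor of order \<open>d\<close>. For larger components the
  naive count fails; they are covered by few containers, found by greedy approximation, and
  excluded with the help of the expansion \<open>|N(S)| - |S| \<ge> |S| / (2 \<surd>d)\<close>, which follows from a functional
  isoperimetric inequality proved by induction on the dimension.\<close>

section \<open>Weighted counting of subsets\<close>

lemma sum_Pow_power_card:
  fixes x :: "'b::comm_semiring_1"
  assumes "finite D"
  shows "(\<Sum>B\<in>Pow D. x ^ card B) = (1 + x) ^ card D"
  using assms
proof (induction D rule: finite_induct)
  case (insert v D)
  have "(\<Sum>B\<in>Pow (insert v D). x ^ card B)
      = (\<Sum>B\<in>Pow D. x ^ card B) + (\<Sum>B\<in>insert v ` Pow D. x ^ card B)"
    unfolding Pow_insert using insert by (intro sum.union_disjoint) auto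
  also have "(\<Sum>B\<in>insert v ` Pow D. x ^ card B) = (\<Sum>B\<in>Pow D. x ^ card (insert v B))"
    using insert by (subst sum.reindex) (auto simp: inj_on_def o_def)
  also have "\<dots> = (\<Sum>B\<in>Pow D. x * x ^ card B)"
  proof (rule sum.cong)
    fix B assume "B \<in> Pow D"
    then have "finite B" "v \<notin> B" using insert finite_subset by auto
    then show "x ^ card (insert v B) = x * x ^ card B" by simp
  qed simp
  also have "\<dots> = x * (1 + x) ^ card D"
    using insert by (simp flip: sum_distrib_left)
  finally show ?case using insert by (simp add: algebra_simps)
qed simp

text \<open>Chernoff-type count: since \<open>x \<le> 1\<close>, every counted \<open>Q\<close> has
  weight \<open>x ^ card Q\<close> at least \<open>x powr k\<close>, whereas all subsets of
  \<open>V\<close> together weigh \<open>(1 + x) ^ card V\<close>.\<close>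

lemma card_subsets_le_powr:
  fixes x k :: real
  assumes "finite V" "0 < x" "x \<le> 1"
  shows "real (card {Q. Q \<subseteq> V \<and> real (card Q) \<le> k}) \<le> (1 / x) powr k * (1 + x) ^ card V"
proof -
  let ?S = "{Q. Q \<subseteq> V \<and> real (card Q) \<le> k}"
  have "real (card ?S) * x powr k = (\<Sum>Q\<in>?S. x powr k)" by simp
  also have "\<dots> \<le> (\<Sum>Q\<in>?S. x ^ card Q)"
  proof (rule sum_mono)
    fix Q assume "Q \<in> ?S"
    then have "x powr k \<le> x powr (real (card Q))"
      using assms by (intro powr_mono') auto
    then show "x powr k \<le> x ^ card Q" using assms by (simp add: powr_realpow)
  qed
  also have "\<dots> \<le> (\<Sum>Q\<in>Pow V. x ^ card Q)"
    using assms by (intro sum_mono2) auto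
  also have "\<dots> = (1 + x) ^ card V" using assms by (intro sum_Pow_power_card)
  finally show ?thesis using assms
    by (simp add: powr_divide field_simps)
qed

lemma card_UNION_le_mult:
  assumes "finite A" "\<And>x. x \<in> A \<Longrightarrow> card (f x) \<le> k"
  shows "card (\<Union>x\<in>A. f x) \<le> card A * k"
proof -
  have "card (\<Union>x\<in>A. f x) \<le> (\<Sum>x\<in>A. card (f x))"
    using assms by (intro card_UN_le)
  also have "\<dots> \<le> (\<Sum>x\<in>A. k)" using assms by (intro sum_mono)
  finally show ?thesis by simp
qed

section \<open>Connected sets of a relation\<close>

text \<open>Connectivity is encoded as growth by one vertex at a time instead of paths between all
  pairs, so finiteness, crossing edges and walks all follow by induction on the growth.\<close>

inductive conn :: "('a \<Rightarrow> 'a \<Rightarrow> bool) \<Rightarrow> 'a set \<Rightarrow> bool" for R where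
  single: "conn R {v}"
| step: "conn R S \<Longrightarrow> x \<in> S \<Longrightarrow> R x y \<Longrightarrow> conn R (insert y S)"

lemma conn_finite: "conn R S \<Longrightarrow> finite S"
  by (induction rule: conn.induct) auto

lemma conn_nonempty: "conn R S \<Longrightarrow> S \<noteq> {}"
  by (induction rule: conn.induct) auto

text \<open>Either \<open>P\<close> already splits the earlier set properly, or one side of the
  split is just the new vertex, and the edge that attached it crosses.\<close>

lemma conn_crossing:
  assumes "conn R S" "\<And>x y. R x y \<Longrightarrow> R y x" "P \<subseteq> S" "P \<noteq> {}" "P \<noteq> S"
  shows "\<exists>x\<in>P. \<exists>y\<in>S - P. R x y"
  using assms(1,3,4,5)
proof (induction arbitrary: P rule: conn.induct)
  case (step S x y)
  consider "P \<inter> S = {}" | "S \<subseteq> P" | "P \<inter> S \<noteq> {}" "P \<inter> S \<noteq> S" by blast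
  then show ?case
  proof cases
    case 1
    then have "P = {y}" using step.prems by auto
    then show ?thesis using assms(2)[OF step.hyps(3)] step.hyps(2) 1 by auto
  next
    case 2
    then show ?thesis using step by blast
  next
    case 3
    then show ?thesis using step.IH[of "P \<inter> S"] by blast
  qed
qed auto

text \<open>The walk goes around a spanning tree: a new vertex \<open>y\<close> attached at
  \<open>x\<close> is spliced in as the detour \<open>x, y, x\<close>, which costs two
  entries.\<close>

lemma conn_walk:
  assumes "conn R S" "\<And>x y. R x y \<Longrightarrow> R y x"
  shows "\<exists>xs. set xs = S \<and> successively R xs \<and> length xs + 1 = 2 * card S"
  using assms(1)
proof (induction rule: conn.induct)
  case (single v)
  show ?case by (rule exI[of _ "[v]"]) simp
next
  case (step S x y)
  then obtain xs where xs: "set xs = S" "successively R xs" "length xs + 1 = 2 * card S" by blast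
  show ?case
  proof (cases "y \<in> S")
    case True
    then show ?thesis using xs by (auto simp: insert_absorb)
  next
    case False
    obtain us vs where uv: "xs = us @ x # vs" using step xs split_list by metis
    have "successively R (us @ x # y # x # vs)"
      using xs(2) step.hyps(3) assms(2)[OF step.hyps(3)] unfolding uv
      by (auto simp: successively_append_iff)
    moreover have "set (us @ x # y # x # vs) = insert y S" using xs(1) uv by auto
    moreover have "length (us @ x # y # x # vs) + 1 = 2 * card (insert y S)"
      using xs uv False conn_finite[OF step.hyps(1)] by simp
    ultimately show ?thesis by blast
  qed
qed

text \<open>Repeating the first vertex, which reflexivity allows, gives all walks the same length,
  as needed for counting them.\<close>

lemma conn_walk_padded:
  assumes "conn R S" "\<And>x y. R x y \<Longrightarrow> R y x" "\<And>x. x \<in> S \<Longrightarrow> R x x" "card S \<le> Suc n"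
  shows "\<exists>xs. set xs = S \<and> successively R xs \<and> length xs = Suc (2 * n)"
proof -
  obtain xs where xs: "set xs = S" "successively R xs" "length xs + 1 = 2 * card S"
    using conn_walk[OF assms(1,2)] by blast
  then have "xs \<noteq> []" using conn_nonempty[OF assms(1)] by auto
  then obtain z zs where z: "xs = z # zs" by (cases xs) auto
  have *: "set (replicate m z @ xs) = S \<and> successively R (replicate m z @ xs)" for m
    using xs assms(3)[of z] z
    by (induction m) (auto simp: successively_Cons hd_append)
  have "length (replicate (Suc (2 * n) - length xs) z @ xs) = Suc (2 * n)"
    using xs(3) assms(4) by simp
  then show ?thesis using * by blast
qed

lemma card_walks:
  assumes "finite V" "\<And>x. x \<in> V \<Longrightarrow> card {y \<in> V. R x y} \<le> D"
  shows "finite {xs. length xs = Suc n \<and> set xs \<subseteq> V \<and> successively R xs} \<and>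
    card {xs. length xs = Suc n \<and> set xs \<subseteq> V \<and> successively R xs} \<le> card V * D ^ n"
proof (induction n)
  case 0
  have "{xs. length xs = Suc 0 \<and> set xs \<subseteq> V \<and> successively R xs} = (\<lambda>x. [x]) ` V"
    by (auto simp: length_Suc_conv)
  then show ?case using assms(1) by (simp add: card_image inj_on_def)
next
  case (Suc n)
  let ?W = "\<lambda>n. {xs. length xs = Suc n \<and> set xs \<subseteq> V \<and> successively R xs}"
  have eq: "?W (Suc n) \<subseteq> (\<Union>xs\<in>?W n. (\<lambda>y. xs @ [y]) ` {y \<in> V. R (last xs) y})"
  proof
    fix xs assume xs: "xs \<in> ?W (Suc n)"
    then have ne: "xs \<noteq> []" "butlast xs \<noteq> []" by (auto simp: length_Suc_conv)
    have xe: "xs = butlast xs @ [last xs]" using ne by simp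
    have "successively R (butlast xs @ [last xs])" using xs unfolding xe[symmetric] by blast
    then have "successively R (butlast xs)" "R (last (butlast xs)) (last xs)"
      using ne(2) by (auto simp only: successively_append_iff list.sel(1) simp_thms list.distinct)
    moreover have "set (butlast xs) \<subseteq> V" "last xs \<in> V" using xs ne
      by (auto dest: in_set_butlastD)
    moreover have "length (butlast xs) = Suc n" using xs by simp
    ultimately show "xs \<in> (\<Union>xs\<in>?W n. (\<lambda>y. xs @ [y]) ` {y \<in> V. R (last xs) y})"
      using xe by blast
  qed
  have "card (\<Union>xs\<in>?W n. (\<lambda>y. xs @ [y]) ` {y \<in> V. R (last xs) y}) \<le> card (?W n) * D"
  proof (rule card_UNION_le_mult)
    fix xs assume xs: "xs \<in> ?W n"
    then have "last xs \<in> V" by (cases xs rule: rev_cases) auto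
    then show "card ((\<lambda>y. xs @ [y]) ` {y \<in> V. R (last xs) y}) \<le> D"
      using assms(2) by (subst card_image) (auto simp: inj_on_def)
  qed (use Suc in simp)
  also have "\<dots> \<le> card V * D ^ n * D" using Suc by simp
  finally have le: "card (\<Union>xs\<in>?W n. (\<lambda>y. xs @ [y]) ` {y \<in> V. R (last xs) y}) \<le> card V * D ^ Suc n"
    by (simp add: mult_ac)
  have fin: "finite (\<Union>xs\<in>?W n. (\<lambda>y. xs @ [y]) ` {y \<in> V. R (last xs) y})"
    using Suc assms(1) by auto
  show ?case using finite_subset[OF eq fin] card_mono[OF fin eq] le by simp
qed

text \<open>Each such set is the range of a padded walk with \<open>2 * n\<close> steps, and a walk
  is determined by its start and one of at most \<open>D\<close> choices per step.\<close>

lemma card_conn_sets: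
  assumes "finite V" "\<And>x. x \<in> V \<Longrightarrow> card {y \<in> V. R x y} \<le> D"
    and "\<And>x y. R x y \<Longrightarrow> R y x" "\<And>x. x \<in> V \<Longrightarrow> R x x"
  shows "card {S. S \<subseteq> V \<and> conn R S \<and> card S \<le> Suc n} \<le> card V * D ^ (2 * n)"
proof -
  let ?W = "{xs. length xs = Suc (2 * n) \<and> set xs \<subseteq> V \<and> successively R xs}"
  have weight: "finite ?W" "card ?W \<le> card V * D ^ (2 * n)"
    using card_walks[of V R D "2 * n"] assms by auto
  have "{S. S \<subseteq> V \<and> conn R S \<and> card S \<le> Suc n} \<subseteq> set ` ?W"
  proof
    fix S assume S: "S \<in> {S. S \<subseteq> V \<and> conn R S \<and> card S \<le> Suc n}"
    then obtain xs where "set xs = S \<and> successively R xs \<and> length xs = Suc (2 * n)"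
      using conn_walk_padded[of R S n] assms(3,4) by blast
    then show "S \<in> set ` ?W" using S by (auto simp: image_iff intro!: exI[of _ xs])
  qed
  then have "card {S. S \<subseteq> V \<and> conn R S \<and> card S \<le> Suc n} \<le> card (set ` ?W)"
    using weight by (intro card_mono) auto
  also have "\<dots> \<le> card ?W" using weight by (intro card_image_le)
  finally show ?thesis using weight by linarith
qed

text \<open>\<open>S\<close> is a maximal connected subset of \<open>A\<close> containing
  \<open>v\<close>; an edge from it to the rest of \<open>A\<close> would let it grow.\<close>

lemma conn_component:
  assumes "finite A" "v \<in> A"
  shows "\<exists>S. conn R S \<and> v \<in> S \<and> S \<subseteq> A \<and> (\<forall>x\<in>S. \<forall>y\<in>A - S. \<not> R x y)"
proof -
  let ?C = "{S. conn R S \<and> v \<in> S \<and> S \<subseteq> A}"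
  have "finite ?C" using assms(1) by (intro finite_subset[of ?C "Pow A"]) auto
  moreover have "{v} \<in> ?C" using assms by (auto intro: conn.single)
  ultimately have "\<exists>S\<in>?C. \<forall>T\<in>?C. S \<subseteq> T \<longrightarrow> S = T"
    by (intro finite_has_maximal) auto
  then obtain S where S: "S \<in> ?C" "\<forall>T\<in>?C. S \<subseteq> T \<longrightarrow> S = T" by (rule bexE)
  have "\<not> R x y" if "x \<in> S" "y \<in> A - S" for x y
  proof
    assume "R x y"
    then have "conn R (insert y S)" using S(1) that conn.step[of R S x y] by blast
    then have "insert y S \<in> ?C" using S(1) that by blast
    then show False using S(2)[rule_format, of "insert y S"] that by blast
  qed
  then show ?thesis using S(1) by blast
qed

section \<open>Isoperimetry in the cube\<close>

definition flip :: "bool list \<Rightarrow> nat \<Rightarrow> bool list" where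
  "flip x i = x[i := \<not> x ! i]"

definition bdry_deg :: "bool list set \<Rightarrow> bool list \<Rightarrow> nat" where
  "bdry_deg A x = card {i. i < length x \<and> flip x i \<notin> A}"

lemma length_flip [simp]: "length (flip x i) = length x"
  by (simp add: flip_def)

lemma flip_Cons_0 [simp]: "flip (b # x) 0 = (\<not> b) # x"
  and flip_Cons_Suc [simp]: "flip (b # x) (Suc i) = b # flip x i"
  by (simp_all add: flip_def)

lemma bdry_deg_le: "bdry_deg A x \<le> length x"
  unfolding bdry_deg_def using card_mono[of "{..<length x}" "{i. i < length x \<and> flip x i \<notin> A}"]
  by auto

lemma bdry_deg_Cons:
  "bdry_deg A (b # x) = bdry_deg {y. b # y \<in> A} x + of_bool ((\<not> b) # x \<notin> A)"
proof -
  have "{i. i < length (b # x) \<and> flip (b # x) i \<notin> A}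
      = Suc ` {i. i < length x \<and> b # flip x i \<notin> A} \<union> (if (\<not> b) # x \<notin> A then {0} else {})"
    (is "?L = ?R")
  proof (rule set_eqI)
    fix i show "i \<in> ?L \<longleftrightarrow> i \<in> ?R" by (cases i) (auto simp: image_iff)
  qed
  then have "bdry_deg A (b # x) = card ?R" unfolding bdry_deg_def by (rule arg_cong)
  also have "\<dots> = card (Suc ` {i. i < length x \<and> b # flip x i \<notin> A})
      + card (if (\<not> b) # x \<notin> A then {0::nat} else {})"
    by (rule card_Un_disjoint) auto
  finally show ?thesis by (auto simp: bdry_deg_def card_image)
qed

text \<open>Minkowski's inequality, obtained as the triangle inequality for the plane vectors
  \<open>(sqrt (h x), sqrt (e x))\<close>.\<close>

lemma sum_sqrt_add_ge:
  fixes h e :: "'a \<Rightarrow> real"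
  assumes "finite A" "\<And>x. x \<in> A \<Longrightarrow> 0 \<le> h x" "\<And>x. x \<in> A \<Longrightarrow> 0 \<le> e x"
  shows "sqrt ((\<Sum>x\<in>A. sqrt (h x))\<^sup>2 + (\<Sum>x\<in>A. sqrt (e x))\<^sup>2) \<le> (\<Sum>x\<in>A. sqrt (h x + e x))"
proof -
  let ?f = "\<lambda>x. (sqrt (h x), sqrt (e x))"
  have "norm (\<Sum>x\<in>A. ?f x) \<le> (\<Sum>x\<in>A. norm (?f x))" by (rule norm_sum)
  moreover have "(\<Sum>x\<in>A. ?f x) = (\<Sum>x\<in>A. sqrt (h x), \<Sum>x\<in>A. sqrt (e x))"
    by (simp add: sum_prod)
  moreover have "(\<Sum>x\<in>A. norm (?f x)) = (\<Sum>x\<in>A. sqrt (h x + e x))"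
    using assms by (intro sum.cong) (auto simp: norm_Pair)
  ultimately show ?thesis by (simp add: norm_Pair)
qed

text \<open>This drives the induction on the dimension; \<open>a\<close> and \<open>b\<close> are
  the densities of a set in the two halves of the cube. The left side exceeds
  \<open>a * (1 - a) + b * (1 - b)\<close> by exactly \<open>(a - b)\<^sup>2 / 2\<close>, and after
  squaring, \<open>a * (1 - a) \<le> 1/4\<close> and \<open>a - b \<le> 1\<close> suffice.\<close>

lemma two_point:
  fixes a b :: real
  assumes "0 \<le> b" "b \<le> a" "a \<le> 1"
  shows "(a + b) * (1 - (a + b) / 2) \<le> sqrt ((a * (1 - a))\<^sup>2 + (a - b)\<^sup>2) + b * (1 - b)"
proof -
  let ?J = "a * (1 - a)" and ?d = "a - b"
  have J: "0 \<le> ?J" using assms by simp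
  have "?J \<le> 1/4" using zero_le_power2[of "a - 1/2"] by (simp add: power2_eq_square algebra_simps)
  have d: "0 \<le> ?d" "?d \<le> 1" using assms by auto
  have "?J * ?d\<^sup>2 + ?d^4 / 4 \<le> ?d\<^sup>2"
  proof -
    have "?J * ?d\<^sup>2 \<le> 1/4 * ?d\<^sup>2" using \<open>?J \<le> 1/4\<close> by (intro mult_right_mono) auto
    moreover have "?d^4 \<le> ?d\<^sup>2" using d by (intro power_decreasing) auto
    moreover have "0 \<le> ?d\<^sup>2" by simp
    ultimately show ?thesis by linarith
  qed
  then have "(?J + ?d\<^sup>2 / 2)\<^sup>2 \<le> ?J\<^sup>2 + ?d\<^sup>2"
    by (simp add: power2_eq_square power4_eq_xxxx field_simps)
  then have "?J + ?d\<^sup>2 / 2 \<le> sqrt (?J\<^sup>2 + ?d\<^sup>2)" by (intro real_le_rsqrt)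
  moreover have "(a + b) * (1 - (a + b) / 2) = ?J + ?d\<^sup>2 / 2 + b * (1 - b)"
    by (simp add: power2_eq_square field_simps)
  ultimately show ?thesis by linarith
qed

lemma card_length_bool: "card {x :: bool list. length x = n} = 2 ^ n"
  using card_lists_length_eq[of "UNIV :: bool set" n] by simp

lemma finite_length_bool [simp]: "finite {x :: bool list. length x = n}"
  using finite_lists_length_eq[of "UNIV :: bool set" n] by simp

text \<open>The cube is cut along its first coordinate. Boundary edges across the cut are counted
  only in the denser slice, where Minkowski's inequality merges them with the induction hypothesis;
  \<open>two_point\<close> then closes the step.\<close>

lemma sum_sqrt_bdry_deg_ge:
  assumes "A \<subseteq> {x. length x = n}"
  shows "real (card A) * (1 - real (card A) / 2 ^ n) \<le> (\<Sum>x\<in>A. sqrt (real (bdry_deg A x)))"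
  using assms
proof (induction n arbitrary: A)
  case 0
  then have "A = {} \<or> A = {[]}" by auto
  then show ?case by auto
next
  case (Suc n)
  define B where "B b = {y. b # y \<in> A}" for b
  have B: "B b \<subseteq> {x. length x = n}" for b using Suc.prems by (auto simp: B_def)
  have finB: "finite (B b)" for b using finite_subset[OF B] by simp
  have A: "A = (\<Union>b. (#) b ` B b)"
  proof (rule set_eqI)
    fix x show "x \<in> A \<longleftrightarrow> x \<in> (\<Union>b. (#) b ` B b)"
      using Suc.prems by (cases x) (auto simp: B_def)
  qed
  have split: "(\<Sum>x\<in>A. f x) = (\<Sum>x\<in>B c. f (c # x)) + (\<Sum>x\<in>B (\<not> c). f ((\<not> c) # x))"
    for f :: "bool list \<Rightarrow> real" and c
  proof -
    have "(\<Sum>x\<in>A. f x) = (\<Sum>b\<in>UNIV. \<Sum>x\<in>(#) b ` B b. f x)"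
      unfolding A using finB by (intro sum.UNION_disjoint) auto
    also have "\<dots> = (\<Sum>b\<in>UNIV. \<Sum>x\<in>B b. f (b # x))"
      by (simp add: sum.reindex)
    finally show ?thesis by (cases c) (simp_all add: UNIV_bool add.commute)
  qed
  obtain c where c: "card (B (\<not> c)) \<le> card (B c)"
    using nat_le_linear[of "card (B True)" "card (B False)"] by (metis (full_types))
  define a b where "a = card (B c) / 2 ^ n" and "b = card (B (\<not> c)) / 2 ^ n"
  have cA: "real (card A) = 2 ^ n * (a + b)"
    using split[of "\<lambda>_. 1" c] by (simp add: a_def b_def field_simps)
  have le1: "card (B b) \<le> 2 ^ n" for b
    using card_mono[OF _ B] by (simp add: card_length_bool)
  have ab: "0 \<le> b" "b \<le> a" "a \<le> 1"
    using c le1[of c] by (auto simp: a_def b_def divide_right_mono)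
  have deg: "bdry_deg A (b # x) = bdry_deg (B b) x + of_bool (x \<notin> B (\<not> b))" for b x
    by (simp add: bdry_deg_Cons B_def)
  have "2 ^ n * (b * (1 - b)) \<le> (\<Sum>x\<in>B (\<not> c). sqrt (real (bdry_deg (B (\<not> c)) x)))"
    using Suc.IH[OF B, of "\<not> c"] by (simp add: b_def)
  \<comment> \<open>In the sparser slice the edges across the cut are discarded.\<close>
  also have "\<dots> \<le> (\<Sum>x\<in>B (\<not> c). sqrt (real (bdry_deg A ((\<not> c) # x))))"
    by (intro sum_mono) (simp add: deg)
  finally have lower: "2 ^ n * (b * (1 - b)) \<le> (\<Sum>x\<in>B (\<not> c). sqrt (real (bdry_deg A ((\<not> c) # x))))" .
  let ?h = "\<lambda>x. real (bdry_deg (B c) x)" and ?e = "\<lambda>x. of_bool (x \<notin> B (\<not> c)) :: real"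
  have P: "2 ^ n * (a * (1 - a)) \<le> (\<Sum>x\<in>B c. sqrt (?h x))"
    using Suc.IH[OF B, of c] by (simp add: a_def)
  \<comment> \<open>A vertex of the denser slice without a partner in the other slice gains one
    boundary edge; the difference of the sizes bounds the number of such vertices from
    below.\<close>
  have "2 ^ n * (a - b) = real (card (B c)) - real (card (B (\<not> c)))"
    by (simp add: a_def b_def field_simps)
  also have "\<dots> \<le> real (card (B c - B (\<not> c)))"
    using diff_card_le_card_Diff[of "B (\<not> c)" "B c"] finB[of "\<not> c"] by linarith
  also have "\<dots> = (\<Sum>x\<in>B c. sqrt (?e x))"
    using finB[of c] by (simp add: of_bool_def if_distrib[of sqrt] sum.If_cases Diff_eq Collect_neg_eq
        cong: if_cong)
  finally have Q: "2 ^ n * (a - b) \<le> (\<Sum>x\<in>B c. sqrt (?e x))" .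
  have "2 ^ n * sqrt ((a * (1 - a))\<^sup>2 + (a - b)\<^sup>2)
      = sqrt ((2 ^ n * (a * (1 - a)))\<^sup>2 + (2 ^ n * (a - b))\<^sup>2)"
    by (simp add: power_mult_distrib real_sqrt_mult flip: distrib_left)
  also have "\<dots> \<le> sqrt ((\<Sum>x\<in>B c. sqrt (?h x))\<^sup>2 + (\<Sum>x\<in>B c. sqrt (?e x))\<^sup>2)"
    using P Q ab by (intro real_sqrt_le_mono add_mono power_mono) auto
  also have "\<dots> \<le> (\<Sum>x\<in>B c. sqrt (?h x + ?e x))"
    using finB by (intro sum_sqrt_add_ge) auto
  also have "\<dots> = (\<Sum>x\<in>B c. sqrt (real (bdry_deg A (c # x))))"
    by (simp add: deg)
  finally have upper: "2 ^ n * sqrt ((a * (1 - a))\<^sup>2 + (a - b)\<^sup>2)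
    \<le> (\<Sum>x\<in>B c. sqrt (real (bdry_deg A (c # x))))" .
  have "real (card A) * (1 - real (card A) / 2 ^ Suc n) = 2 ^ n * ((a + b) * (1 - (a + b) / 2))"
    by (simp add: cA)
  also have "\<dots> \<le> 2 ^ n * (sqrt ((a * (1 - a))\<^sup>2 + (a - b)\<^sup>2) + b * (1 - b))"
    using two_point[OF ab] by (intro mult_left_mono) auto
  also have "\<dots> \<le> (\<Sum>x\<in>A. sqrt (real (bdry_deg A x)))"
    using upper lower by (simp add: split[of _ c] distrib_left)
  finally show ?case .
qed

text \<open>The functional inequality is applied to the complement of \<open>S\<close>: there
  \<open>bdry_deg\<close> vanishes off the outer vertex boundary of \<open>S\<close>, and each
  boundary vertex contributes at most \<open>sqrt n\<close>.\<close>

lemma vertex_bdry_ge: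
  assumes "S \<subseteq> {x. length x = n}" "2 * card S \<le> 2 ^ n"
  shows "real (card S) \<le> 2 * sqrt n * real (card {x. length x = n \<and> x \<notin> S \<and> (\<exists>i<n. flip x i \<in> S)})"
proof -
  let ?A = "{x. length x = n} - S"
  let ?D = "{x. length x = n \<and> x \<notin> S \<and> (\<exists>i<n. flip x i \<in> S)}"
  have finS: "finite S" using assms(1) finite_subset by fastforce
  have cA: "real (card ?A) = 2 ^ n - real (card S)"
    using assms(1) finS card_mono[OF _ assms(1)]
    by (simp add: card_Diff_subset card_length_bool of_nat_diff)
  have s: "2 * real (card S) \<le> 2 ^ n" using assms(2) of_nat_mono by fastforce
  have D: "bdry_deg ?A x = 0" if "x \<in> ?A" "x \<notin> ?D" for x
  proof -
    have "{i. i < length x \<and> flip x i \<notin> ?A} = {}" using that by auto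
    then show ?thesis unfolding bdry_deg_def by (metis card.empty)
  qed
  \<comment> \<open>The complement has density at least 1/2, and one minus its density is the
    density of \<open>S\<close>.\<close>
  have "real (card S) / 2 \<le> real (card ?A) * (1 - real (card ?A) / 2 ^ n)"
  proof -
    have "real (card ?A) * (1 - real (card ?A) / 2 ^ n) = (real (card ?A) / 2 ^ n) * real (card S)"
      unfolding cA by (simp add: field_simps)
    also have "\<dots> \<ge> 1/2 * real (card S)"
      using s unfolding cA by (intro mult_right_mono) (auto simp: field_simps)
    finally show ?thesis by simp
  qed
  also have "\<dots> \<le> (\<Sum>x\<in>?A. sqrt (real (bdry_deg ?A x)))"
    by (rule sum_sqrt_bdry_deg_ge) auto
  also have "\<dots> = (\<Sum>x\<in>?D. sqrt (real (bdry_deg ?A x)))"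
  proof (rule sum.mono_neutral_right)
    show "\<forall>x\<in>?A - ?D. sqrt (real (bdry_deg ?A x)) = 0"
    proof
      fix x assume "x \<in> ?A - ?D"
      then have "bdry_deg ?A x = 0" by (rule DiffE) (rule D)
      then show "sqrt (real (bdry_deg ?A x)) = 0" by (simp only: of_nat_0 real_sqrt_zero)
    qed
  qed auto
  also have "\<dots> \<le> (\<Sum>x\<in>?D. sqrt n)"
    using bdry_deg_le[of ?A] by (intro sum_mono) fastforce
  finally show ?thesis by (simp add: mult.commute)
qed

subsection \<open>Neighbourhoods\<close>

definition cube_nb :: "bool list \<Rightarrow> bool list set" where
  "cube_nb x = flip x ` {..<length x}"

lemma inj_on_flip: "inj_on (flip x) {..<length x}"
proof (rule inj_onI)
  fix i j assume "i \<in> {..<length x}" "j \<in> {..<length x}" "flip x i = flip x j"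
  then have "flip x i ! i = flip x j ! i" "i < length x" by auto
  then show "i = j" by (cases "i = j") (auto simp: flip_def)
qed

lemma card_cube_nb: "card (cube_nb x) = length x"
  by (simp add: cube_nb_def card_image inj_on_flip)

lemma nth_flip: "i < length x \<Longrightarrow> j < length x \<Longrightarrow> flip x i ! j = (if i = j then \<not> x ! j else x ! j)"
  by (simp add: flip_def)

lemma cube_adj_iff: "x \<in> cube_verts d \<Longrightarrow> cube_adj d x y \<longleftrightarrow> y \<in> cube_nb x"
proof
  assume x: "x \<in> cube_verts d" and a: "cube_adj d x y"
  then obtain i where i: "i < d" "x ! i \<noteq> y ! i" "\<And>j. j < d \<Longrightarrow> x ! j \<noteq> y ! j \<Longrightarrow> j = i"
    unfolding cube_adj_def by blast
  have len: "length x = d" "length y = d" using a by (simp_all add: cube_adj_def cube_verts_def)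
  have "y ! k = flip x i ! k" if "k < d" for k
  proof (cases "k = i")
    case True
    then show ?thesis using i(1,2) len by (simp add: nth_flip)
  next
    case False
    then have "x ! k = y ! k" using i(3)[OF that] by blast
    then show ?thesis using False that len i(1) by (simp add: nth_flip)
  qed
  then have "y = flip x i" using len by (intro nth_equalityI) auto
  then show "y \<in> cube_nb x" using len i(1) by (auto simp: cube_nb_def)
next
  assume x: "x \<in> cube_verts d" and "y \<in> cube_nb x"
  then obtain i where "i < d" "y = flip x i" by (auto simp: cube_nb_def cube_verts_def)
  then show "cube_adj d x y" using x
    by (auto simp: cube_adj_def cube_verts_def nth_flip intro!: ex1I[of _ i] split: if_splits)
qed

lemma flip_flip: "i < length x \<Longrightarrow> flip (flip x i) i = x"
  by (simp add: flip_def)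

lemma cube_nb_sym: "y \<in> cube_nb x \<longleftrightarrow> x \<in> cube_nb y"
proof -
  have "y \<in> cube_nb x \<Longrightarrow> x \<in> cube_nb y" for x y
    using flip_flip[of _ x] by (force simp: cube_nb_def)
  then show ?thesis by blast
qed

text \<open>If \<open>flip x i = flip y j\<close> and \<open>x \<noteq> y\<close>, then
  \<open>i\<close> is a position where the strings differ, and there are no such positions besides
  \<open>i\<close> and \<open>j\<close>. So every common neighbour flips \<open>x\<close> at one of
  at most two positions.\<close>

lemma card_common_cube_nb_le:
  assumes "x \<noteq> y"
  shows "card (cube_nb x \<inter> cube_nb y) \<le> 2"
proof (cases "cube_nb x \<inter> cube_nb y = {}")
  case False
  define D where "D = {k. k < length x \<and> x ! k \<noteq> y ! k}"
  have key: "i \<in> D \<and> D \<subseteq> {i, j}" if "i < length x" "j < length y" "flip x i = flip y j" for i j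
  proof -
    have len: "length x = length y" using that(3) by (metis length_flip)
    have eq: "(if i = k then \<not> x ! k else x ! k) = (if j = k then \<not> y ! k else y ! k)"
      if "k < length x" for k
      using arg_cong[OF \<open>flip x i = flip y j\<close>, of "\<lambda>l. l ! k"] that len \<open>i < _\<close> \<open>j < _\<close>
      by (simp add: nth_flip)
    have "i \<noteq> j"
    proof
      assume "i = j"
      then have "x ! k = y ! k" if "k < length x" for k
        using eq[OF that] by (cases "j = k") auto
      then have "x = y" using len by (intro nth_equalityI)
      then show False using assms by simp
    qed
    then show ?thesis using eq that by (fastforce simp: D_def split: if_splits)
  qed
  obtain i j where "i < length x" "j < length y" "flip x i = flip y j"
    using False by (auto simp: cube_nb_def)
  then have D: "D \<subseteq> {i, j}" using key by blast
  have "cube_nb x \<inter> cube_nb y \<subseteq> flip x ` D"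
    using key by (force simp: cube_nb_def)
  also have "\<dots> \<subseteq> {flip x i, flip x j}" using D by auto
  finally have "card (cube_nb x \<inter> cube_nb y) \<le> card {flip x i, flip x j}"
    by (intro card_mono) auto
  then show ?thesis using card_insert_le_m1[of 2 "{flip x j}" "flip x i"] by simp
qed simp

lemma parity_flip: "i < length x \<Longrightarrow> even (count_list (flip x i) True) \<longleftrightarrow> odd (count_list x True)"
proof (induction x arbitrary: i)
  case (Cons b x)
  then show ?case by (cases i) auto
qed simp

lemma tl_parity_inj:
  assumes "x \<noteq> []" "y \<noteq> []" "tl x = tl y" "even (count_list x True) = even (count_list y True)"
  shows "x = y"
  using assms by (cases x; cases y) (auto split: if_splits)

text \<open>Indexed by the parity so that one statement about \<open>p\<close> covers both
  bipartition classes.\<close>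

definition cube_par :: "bool \<Rightarrow> nat \<Rightarrow> bool list set" where
  "cube_par p d = {x. length x = d \<and> even (count_list x True) = p}"

lemma cube_even_eq: "cube_even d = cube_par True d" and cube_odd_eq: "cube_odd d = cube_par False d"
  by (auto simp: cube_even_def cube_odd_def cube_par_def cube_verts_def)

lemma cube_nb_par: "x \<in> cube_par p d \<Longrightarrow> cube_nb x \<subseteq> cube_par (\<not> p) d"
  by (auto simp: cube_nb_def cube_par_def parity_flip)

lemma inj_on_tl_par: "inj_on tl (cube_par p (Suc n))"
  by (rule inj_onI) (auto simp: cube_par_def intro!: tl_parity_inj)

lemma tl_image_par: "tl ` cube_par p (Suc n) = {x. length x = n}"
proof
  show "{x. length x = n} \<subseteq> tl ` cube_par p (Suc n)"
  proof
    fix x :: "bool list" assume x: "x \<in> {x. length x = n}"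
    let ?b = "even (count_list x True) \<noteq> p"
    have "?b # x \<in> cube_par p (Suc n)" using x by (auto simp: cube_par_def)
    then show "x \<in> tl ` cube_par p (Suc n)" by force
  qed
qed (auto simp: cube_par_def)

lemma card_cube_par: "card (cube_par p (Suc n)) = 2 ^ n"
  using card_image[OF inj_on_tl_par[of p n]] by (simp add: tl_image_par card_length_bool)

text \<open>Deleting the first coordinate identifies both parity classes with the cube of one dimension
  less, and turns neighbourhoods into closed neighbourhoods.\<close>

lemma cube_expansion:
  assumes "S \<subseteq> cube_par p (Suc n)" "2 * card S \<le> 2 ^ n"
  shows "real (card S) \<le> 2 * sqrt n * (real (card (\<Union>x\<in>S. cube_nb x)) - real (card S))"
proof -
  let ?T = "tl ` S" and ?NS = "\<Union>x\<in>S. cube_nb x"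
  let ?D = "{x. length x = n \<and> x \<notin> ?T \<and> (\<exists>i<n. flip x i \<in> ?T)}"
  have finS: "finite S"
    using assms(1) by (rule finite_subset) (simp add: cube_par_def)
  have finN: "finite ?NS" using finS by (auto simp: cube_nb_def)
  have cT: "card ?T = card S"
    by (rule card_image) (rule inj_on_subset[OF inj_on_tl_par assms(1)])
  have T: "?T \<subseteq> {x. length x = n}" using assms(1) by (auto simp: cube_par_def)
  have "?T \<union> ?D \<subseteq> tl ` ?NS"
  proof
    fix x assume "x \<in> ?T \<union> ?D"
    then consider y where "y \<in> S" "x = tl y" | i y where "length x = n" "i < n" "y \<in> S" "flip x i = tl y"
      by blast
    then show "x \<in> tl ` ?NS"
    proof cases
      case 1
      then obtain b where y: "y = b # x" using assms(1) by (cases y) (auto simp: cube_par_def)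
      then have "(\<not> b) # x = flip y 0" "0 < length y" by simp_all
      then have "(\<not> b) # x \<in> ?NS" using 1(1) unfolding cube_nb_def by blast
      from imageI[OF this, of tl] show ?thesis by simp
    next
      case 2
      then obtain b where y: "y = b # flip x i" using assms(1) by (cases y) (auto simp: cube_par_def)
      have "b # x = flip y (Suc i)" "Suc i < length y"
        unfolding y using 2(1,2) by (simp_all add: flip_flip)
      then have "b # x \<in> ?NS" using 2(3) unfolding cube_nb_def by blast
      from imageI[OF this, of tl] show ?thesis by simp
    qed
  qed
  then have "card (?T \<union> ?D) \<le> card (tl ` ?NS)" using finN by (intro card_mono) auto
  also have "\<dots> \<le> card ?NS" using finN by (rule card_image_le)
  also have "card (?T \<union> ?D) = card ?T + card ?D"
    using finS by (intro card_Un_disjoint) (auto intro: finite_subset[of _ "{x. length x = n}"])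
  finally have D: "real (card ?D) \<le> real (card ?NS) - real (card S)" using cT by linarith
  have "card ?T \<le> 2 * sqrt n * real (card ?D)"
    using vertex_bdry_ge[OF T] assms(2) unfolding cT by blast
  also have "\<dots> \<le> 2 * sqrt n * (real (card ?NS) - real (card S))"
    by (rule mult_left_mono[OF D]) simp
  finally show ?thesis unfolding cT .
qed

section \<open>Containers in regular bipartite graphs\<close>

lemma sum_UNION_le_mult:
  fixes f :: "'b \<Rightarrow> real"
  assumes "finite I" "\<And>i. i \<in> I \<Longrightarrow> finite (A i)" "\<And>x. 0 \<le> f x"
    and "\<And>i. i \<in> I \<Longrightarrow> sum f (A i) \<le> c"
  shows "sum f (\<Union>i\<in>I. A i) \<le> real (card I) * c"
  using assms(1,2,4)
proof (induction I rule: finite_induct)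
  case (insert i I)
  have "sum f (\<Union>i\<in>insert i I. A i) \<le> sum f (A i) + sum f (\<Union>i\<in>I. A i)"
    using insert.prems insert.hyps assms(3) by (simp add: sum_Un sum_nonneg)
  also have "\<dots> \<le> c + real (card I) * c"
    using insert by (intro add_mono) auto
  finally show ?case using insert.hyps by (simp add: algebra_simps)
qed simp

lemma card_eq_sum_of_bool:
  "finite F \<Longrightarrow> card (A \<inter> F) = (\<Sum>u\<in>F. of_bool (u \<in> A))"
  by (simp add: of_bool_def sum.If_cases Int_commute)

lemma card_Int_plus_Diff: "finite A \<Longrightarrow> card (A \<inter> B) + card (A - B) = card A"
  using sum.Int_Diff[of A "\<lambda>_. 1::nat" B] by simp

text \<open>The assumptions are symmetric in \<open>X\<close> and \<open>Y\<close>, so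
  \<open>dual\<close> carries every result proved here for one side over to the other.\<close>

locale bireg =
  fixes X Y :: "'a set" and nb :: "'a \<Rightarrow> 'a set" and d :: nat
  assumes finX: "finite X" and finY: "finite Y" and disjoint: "X \<inter> Y = {}"
    and nbX: "x \<in> X \<Longrightarrow> nb x \<subseteq> Y" and nbY: "y \<in> Y \<Longrightarrow> nb y \<subseteq> X"
    and nb_sym: "y \<in> nb x \<longleftrightarrow> x \<in> nb y"
    and deg: "x \<in> X \<union> Y \<Longrightarrow> card (nb x) = d" and d_pos: "0 < d"
    and card_eq: "card X = card Y"
begin

definition NB :: "'a set \<Rightarrow> 'a set" where
  "NB S = (\<Union>v\<in>S. nb v)"

definition cl :: "'a set \<Rightarrow> 'a set" where
  "cl S = {v\<in>X. nb v \<subseteq> NB S}"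

definition linked2 :: "'a \<Rightarrow> 'a \<Rightarrow> bool" where
  "linked2 x y \<longleftrightarrow> nb x \<inter> nb y \<noteq> {}"

text \<open>Distance at most 4. The middle vertex \<open>z\<close> need not belong to the set under
  consideration, so a sparse sample of a \<open>linked2\<close>-connected set can still be
  \<open>linked4\<close>-connected.\<close>

definition linked4 :: "'a \<Rightarrow> 'a \<Rightarrow> bool" where
  "linked4 x y \<longleftrightarrow> (\<exists>z\<in>X. linked2 x z \<and> linked2 z y)"

lemma dual: "bireg Y X nb d"
  using finX finY disjoint nbX nbY nb_sym deg d_pos card_eq
  by unfold_locales auto

lemma NB_mono: "S \<subseteq> T \<Longrightarrow> NB S \<subseteq> NB T"
  by (auto simp: NB_def)

lemma NB_X: "S \<subseteq> X \<Longrightarrow> NB S \<subseteq> Y"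
  unfolding NB_def using nbX by blast

lemma NB_insert: "NB (insert v S) = nb v \<union> NB S"
  by (auto simp: NB_def)

lemma fin_nb: "x \<in> X \<union> Y \<Longrightarrow> finite (nb x)"
  using deg[of x] d_pos card_gt_0_iff[of "nb x"] by simp

lemma nb_nonempty: "x \<in> X \<union> Y \<Longrightarrow> nb x \<noteq> {}"
  using deg[of x] d_pos by force

lemma finite_NB: "S \<subseteq> X \<Longrightarrow> finite (NB S)"
  using NB_X finY finite_subset by blast

lemma finite_sub_X: "S \<subseteq> X \<Longrightarrow> finite S"
  using finX finite_subset by blast

lemma finite_sub_Y: "S \<subseteq> Y \<Longrightarrow> finite S"
  using finY finite_subset by blast

lemma card_NB_le: "S \<subseteq> X \<Longrightarrow> card (NB S) \<le> d * card S"
  unfolding NB_def using card_UNION_le_mult[of S nb d] deg finite_sub_X by (auto simp: mult.commute)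

lemma edge_count:
  assumes "H \<subseteq> X" "F \<subseteq> Y"
  shows "(\<Sum>v\<in>H. card (nb v \<inter> F)) = (\<Sum>u\<in>F. card (nb u \<inter> H))"
proof -
  have "(\<Sum>v\<in>H. card (nb v \<inter> F)) = (\<Sum>v\<in>H. \<Sum>u\<in>F. of_bool (u \<in> nb v))"
    using assms finite_sub_Y by (simp add: card_eq_sum_of_bool)
  also have "\<dots> = (\<Sum>u\<in>F. \<Sum>v\<in>H. of_bool (v \<in> nb u))"
    using nb_sym by (subst sum.swap) simp
  also have "\<dots> = (\<Sum>u\<in>F. card (nb u \<inter> H))"
    using assms finite_sub_X by (simp add: card_eq_sum_of_bool)
  finally show ?thesis .
qed

text \<open>Double counting: the \<open>d * card S\<close> edges leaving \<open>S\<close> end in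
  \<open>NB S\<close>, where no vertex receives more than \<open>d\<close> of them.\<close>

lemma card_le_card_NB:
  assumes "S \<subseteq> X"
  shows "card S \<le> card (NB S)"
proof -
  have "d * card S = (\<Sum>v\<in>S. card (nb v \<inter> NB S))"
  proof -
    have "card (nb v \<inter> NB S) = d" if "v \<in> S" for v
    proof -
      have "nb v \<inter> NB S = nb v" using that by (auto simp: NB_def)
      then show ?thesis using deg that assms by auto
    qed
    then show ?thesis by simp
  qed
  also have "\<dots> = (\<Sum>u\<in>NB S. card (nb u \<inter> S))"
    using assms NB_X by (intro edge_count) auto
  also have "\<dots> \<le> (\<Sum>u\<in>NB S. d)"
  proof (rule sum_mono)
    fix u assume "u \<in> NB S"
    then have "u \<in> Y" using NB_X assms by auto
    then show "card (nb u \<inter> S) \<le> d" using deg[of u] card_mono[OF fin_nb[of u], of "nb u \<inter> S"] by auto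
  qed
  finally show ?thesis using d_pos by simp
qed

lemma linked2_sym: "linked2 x y \<Longrightarrow> linked2 y x"
  by (auto simp: linked2_def)

lemma linked4_sym: "linked4 x y \<Longrightarrow> linked4 y x"
  by (auto simp: linked4_def intro: linked2_sym)

lemma linked2_refl: "x \<in> X \<Longrightarrow> linked2 x x"
  using nb_nonempty by (simp add: linked2_def)

lemma linked4_refl: "x \<in> X \<Longrightarrow> linked4 x x"
  using linked2_refl by (auto simp: linked4_def)

lemma card_linked2: 
  assumes "x \<in> X"
  shows "card {y\<in>X. linked2 x y} \<le> d ^ 2"
proof -
  have "{y\<in>X. linked2 x y} \<subseteq> (\<Union>u\<in>nb x. nb u)" using nb_sym by (auto simp: linked2_def)
  moreover have "finite (\<Union>u\<in>nb x. nb u)" using nbX[OF assms] fin_nb assms by auto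
  ultimately have "card {y\<in>X. linked2 x y} \<le> card (\<Union>u\<in>nb x. nb u)" by (rule card_mono[rotated])
  also have "\<dots> \<le> card (nb x) * d"
    using nbX[OF assms] deg fin_nb assms by (intro card_UNION_le_mult) auto
  finally show ?thesis using deg[of x] assms by (simp add: power2_eq_square)
qed

lemma card_linked4:
  assumes "x \<in> X"
  shows "card {y\<in>X. linked4 x y} \<le> d ^ 4"
proof -
  have "{y\<in>X. linked4 x y} \<subseteq> (\<Union>z\<in>{z\<in>X. linked2 x z}. {y\<in>X. linked2 z y})" by (auto simp: linked4_def)
  moreover have "finite (\<Union>z\<in>{z\<in>X. linked2 x z}. {y\<in>X. linked2 z y})" using finX by auto
  ultimately have "card {y\<in>X. linked4 x y} \<le> card (\<Union>z\<in>{z\<in>X. linked2 x z}. {y\<in>X. linked2 z y})"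
    by (rule card_mono[rotated])
  also have "\<dots> \<le> card {z\<in>X. linked2 x z} * d ^ 2"
    using card_linked2 finX by (intro card_UNION_le_mult) auto
  also have "\<dots> \<le> d ^ 2 * d ^ 2" using card_linked2[OF assms] by (intro mult_right_mono) auto
  finally show ?thesis by (simp flip: power_add)
qed

lemma subset_cl: "S \<subseteq> X \<Longrightarrow> S \<subseteq> cl S"
  by (auto simp: cl_def NB_def)

lemma cl_subset: "cl S \<subseteq> X"
  by (auto simp: cl_def)

lemma cl_mono: "S \<subseteq> T \<Longrightarrow> cl S \<subseteq> cl T"
  unfolding cl_def using NB_mono[of S T] by blast

lemma NB_cl: "S \<subseteq> X \<Longrightarrow> NB (cl S) = NB S"
  using subset_cl[of S] NB_mono[of S "cl S"] unfolding cl_def NB_def by blast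

text \<open>A vertex of the closure shares a neighbour with some vertex of \<open>S\<close>, so the
  whole closure can be attached to \<open>S\<close> one vertex at a time.\<close>

lemma conn_cl:
  assumes "S \<subseteq> X" "conn linked2 S"
  shows "conn linked2 (cl S)"
proof -
  have "conn linked2 (S \<union> T)" if "finite T" "T \<subseteq> cl S" for T
    using that
  proof (induction T rule: finite_induct)
    case (insert v T)
    then have "v \<in> X" "nb v \<subseteq> NB S" by (auto simp: cl_def)
    moreover obtain u where "u \<in> nb v" using nb_nonempty[of v] \<open>v \<in> X\<close> by blast
    ultimately obtain x where "u \<in> nb v" "x \<in> S" "u \<in> nb x"
      unfolding NB_def by blast
    then have "linked2 x v" "x \<in> S \<union> T" by (auto simp: linked2_def)
    then have "conn linked2 (insert v (S \<union> T))" using insert by (intro conn.step) auto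
    then show ?case by simp
  qed (use assms in simp)
  from this[of "cl S"] show ?thesis
    using finite_sub_X[OF cl_subset] subset_cl[OF assms(1)] by (simp add: Un_absorb1)
qed

subsection \<open>Approximating a closed connected set\<close>

text \<open>Greedy choice: \<open>T\<close> is maximal among the \<open>linked4\<close>-connected
  sets that gain \<open>psi\<close> neighbours per vertex on average. If some vertex of
  \<open>K\<close> were poorly covered, a crossing edge would lead from a well covered
  \<open>x\<close> to a poorly covered \<open>y\<close>. As \<open>psi \<le> d\<close>, some
  neighbour of \<open>x\<close> lies in \<open>NB T\<close>, so \<open>y\<close> is within distance
  4 of \<open>T\<close>, and adding it gains at least \<open>psi\<close> neighbours.\<close>

lemma connected_approx:
  fixes psi :: real
  assumes "K \<subseteq> X" "conn linked2 K" "0 < psi" "psi \<le> d"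
  shows "\<exists>T\<subseteq>K. conn linked4 T \<and> psi * card T \<le> card (NB T) \<and> (\<forall>v\<in>K. card (nb v - NB T) < psi)"
proof -
  let ?C = "{T. T \<subseteq> K \<and> conn linked4 T \<and> psi * card T \<le> card (NB T)}"
  obtain v0 where v0: "v0 \<in> K" using conn_nonempty[OF assms(2)] by blast
  have "finite ?C" using finite_sub_X[OF assms(1)] by (intro finite_subset[of ?C "Pow K"]) auto
  moreover have "{v0} \<in> ?C"
    using v0 assms deg[of v0] by (auto intro: conn.single simp: NB_def)
  ultimately have "\<exists>T\<in>?C. \<forall>T'\<in>?C. T \<subseteq> T' \<longrightarrow> T = T'"
    by (intro finite_has_maximal) auto
  then obtain T where "T \<in> ?C" and max: "\<forall>T'\<in>?C. T \<subseteq> T' \<longrightarrow> T = T'" by (rule bexE)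
  then have T: "T \<subseteq> K" "conn linked4 T" "psi * card T \<le> card (NB T)" by auto
  have finT: "finite T" "finite (NB T)"
    using T(1) assms(1) finite_sub_X finite_NB by auto
  let ?P = "{v\<in>K. card (nb v - NB T) < psi}"
  have "?P = K"
  proof (rule ccontr)
    assume "?P \<noteq> K"
    moreover have "T \<subseteq> ?P"
    proof
      fix v assume "v \<in> T"
      then have "nb v - NB T = {}" by (auto simp: NB_def)
      then have "card (nb v - NB T) = 0" by (metis card.empty)
      then show "v \<in> ?P" using T \<open>v \<in> T\<close> assms(3) by auto
    qed
    then have "?P \<noteq> {}" using conn_nonempty[OF T(2)] by blast
    ultimately have "\<exists>x\<in>?P. \<exists>y\<in>K - ?P. linked2 x y"
      by (intro conn_crossing[OF assms(2) linked2_sym]) auto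
    then obtain x y where xy: "x \<in> ?P" "y \<in> K" "y \<notin> ?P" "linked2 x y" by blast
    have x: "x \<in> X" using xy assms(1) by blast
    have "nb x \<inter> NB T \<noteq> {}"
    proof
      assume "nb x \<inter> NB T = {}"
      then have "nb x - NB T = nb x" by blast
      then show False using xy(1) deg[of x] x assms(4) by simp
    qed
    then obtain w where w: "w \<in> T" "linked2 w x" by (auto simp: NB_def linked2_def)
    then have "linked4 w y" using x xy(4) by (auto simp: linked4_def)
    then have c: "conn linked4 (insert y T)" using T(2) w(1) conn.step by metis
    have "y \<notin> T" using xy(2,3) \<open>T \<subseteq> ?P\<close> by blast
    have "card (NB (insert y T)) = card (nb y - NB T) + card (NB T)"
    proof -
      have "NB (insert y T) = (nb y - NB T) \<union> NB T" by (auto simp: NB_insert)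
      moreover have "finite (nb y)" using xy(2) assms(1) fin_nb by blast
      ultimately show ?thesis using finT card_Un_disjoint[of "nb y - NB T" "NB T"] by auto
    qed
    moreover have "psi \<le> card (nb y - NB T)" using xy by auto
    ultimately have "psi * card (insert y T) \<le> card (NB (insert y T))"
      using T(3) finT \<open>y \<notin> T\<close> by (simp add: algebra_simps)
    then have "insert y T \<in> ?C" using c xy(2) T(1) by auto
    then show False using max \<open>y \<notin> T\<close> by blast
  qed
  then show ?thesis using T by blast
qed

definition near_covered :: "real \<Rightarrow> 'a set \<Rightarrow> 'a set" where
  "near_covered psi T = {v\<in>X. real (card (nb v - NB T)) < psi}"

text \<open>In \<open>closed_approx\<close> the set \<open>T2\<close> avoids \<open>NB S\<close>, so
  a vertex adjacent to \<open>T2\<close> cannot lie in \<open>cl S\<close> and may be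
  removed.\<close>

definition outer :: "real \<Rightarrow> 'a set \<Rightarrow> 'a set \<Rightarrow> 'a set" where
  "outer psi T1 T2 = near_covered psi T1 - NB T2"

text \<open>In \<open>closed_approx\<close> the choice of \<open>T2\<close> leaves every vertex of
  \<open>Y\<close> outside \<open>NB S\<close> with fewer than \<open>psi\<close> neighbours in
  \<open>outer\<close>; hence the vertices added to \<open>NB T1\<close> do belong to
  \<open>NB S\<close>.\<close>

definition inner :: "real \<Rightarrow> 'a set \<Rightarrow> 'a set \<Rightarrow> 'a set" where
  "inner psi T1 T2 = NB T1 \<union> {u\<in>Y. psi \<le> real (card (nb u \<inter> outer psi T1 T2))}"

lemma near_covered_subset: "near_covered psi T \<subseteq> X" and outer_subset: "outer psi T T' \<subseteq> X"
  by (auto simp: near_covered_def outer_def)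

text \<open>Double counting: each near-covered vertex has at least \<open>d / 2\<close> neighbours
  in \<open>NB T\<close>, and each vertex there has degree \<open>d\<close>.\<close>

lemma card_near_covered_le:
  fixes psi :: real
  assumes "T \<subseteq> X" "2 * psi \<le> d"
  shows "card (near_covered psi T) \<le> 2 * card (NB T)"
proof -
  let ?H = "near_covered psi T"
  have "real d / 2 * card ?H = (\<Sum>v\<in>?H. real d / 2)" by simp
  also have "\<dots> \<le> (\<Sum>v\<in>?H. real (card (nb v \<inter> NB T)))"
  proof (rule sum_mono)
    fix v assume v: "v \<in> ?H"
    then have "v \<in> X" by (simp add: near_covered_def)
    then have "card (nb v - NB T) + card (nb v \<inter> NB T) = d"
      using card_Int_plus_Diff[of "nb v" "NB T"] deg[of v] fin_nb[of v] by simp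
    moreover have "card (nb v - NB T) < psi" using v by (simp add: near_covered_def)
    ultimately show "real d / 2 \<le> card (nb v \<inter> NB T)" using assms(2) by linarith
  qed
  also have "\<dots> = real (\<Sum>u\<in>NB T. card (nb u \<inter> ?H))"
    using edge_count[OF near_covered_subset NB_X[OF assms(1)], of psi T] by (simp flip: of_nat_sum)
  also have "\<dots> \<le> real (\<Sum>u\<in>NB T. d)"
  proof (intro of_nat_mono sum_mono)
    fix u assume "u \<in> NB T"
    then have "u \<in> Y" using NB_X assms by auto
    then show "card (nb u \<inter> ?H) \<le> d" using deg[of u] card_mono[OF fin_nb[of u], of "nb u \<inter> ?H"] by auto
  qed
  finally have "real d * (real (card ?H)) \<le> real d * (2 * real (card (NB T)))"
    by (simp add: mult_ac)
  then show ?thesis using d_pos by simp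
qed

text \<open>Greedy again: \<open>T\<close> is maximal such that its members cover \<open>psi\<close>
  vertices of \<open>H\<close> each on average; a vertex outside \<open>G\<close> with
  \<open>psi\<close> uncovered neighbours in \<open>H\<close> could still be added.\<close>

lemma outside_approx:
  fixes psi :: real
  assumes "G \<subseteq> Y" "H \<subseteq> X" "0 < psi"
  shows "\<exists>T\<subseteq>(Y - G) \<inter> NB H. psi * card T \<le> card H \<and> (\<forall>u\<in>Y - G. card (nb u \<inter> (H - NB T)) < psi)"
proof -
  let ?C = "{T. T \<subseteq> (Y - G) \<inter> NB H \<and> psi * card T \<le> card (H \<inter> NB T)}"
  have "finite ?C" using finY by (intro finite_subset[of ?C "Pow Y"]) auto
  moreover have "{} \<in> ?C" by simp
  ultimately have "\<exists>T\<in>?C. \<forall>T'\<in>?C. T \<subseteq> T' \<longrightarrow> T = T'"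
    by (intro finite_has_maximal) auto
  then obtain T where "T \<in> ?C" and max: "\<forall>T'\<in>?C. T \<subseteq> T' \<longrightarrow> T = T'" by (rule bexE)
  then have T: "T \<subseteq> (Y - G) \<inter> NB H" "psi * card T \<le> card (H \<inter> NB T)" by auto
  have finT: "finite T" "finite H"
    using T(1) finite_sub_Y assms(2) finite_sub_X by auto
  have "card (nb u \<inter> (H - NB T)) < psi" if u: "u \<in> Y - G" for u
  proof (rule ccontr)
    assume a: "\<not> card (nb u \<inter> (H - NB T)) < psi"
    then have "card (nb u \<inter> (H - NB T)) \<noteq> 0" using assms(3) by auto
    then have ne: "nb u \<inter> (H - NB T) \<noteq> {}" by (metis card.empty)
    then have "u \<notin> T" by (auto simp: NB_def)
    have "u \<in> NB H" using ne nb_sym by (auto simp: NB_def)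
    have "card (H \<inter> NB (insert u T)) = card (nb u \<inter> (H - NB T)) + card (H \<inter> NB T)"
    proof -
      have "H \<inter> NB (insert u T) = nb u \<inter> (H - NB T) \<union> H \<inter> NB T" by (auto simp: NB_insert)
      moreover have "nb u \<inter> (H - NB T) \<inter> (H \<inter> NB T) = {}" by blast
      ultimately show ?thesis using finT by (simp add: card_Un_disjoint)
    qed
    then have "psi * card (insert u T) \<le> card (H \<inter> NB (insert u T))"
      using T(2) a finT \<open>u \<notin> T\<close> by (simp add: algebra_simps)
    then have "insert u T \<in> ?C" using T(1) u \<open>u \<in> NB H\<close> by auto
    then show False using max \<open>u \<notin> T\<close> by blast
  qed
  moreover have "psi * card T \<le> card H"
  proof -
    have "card (H \<inter> NB T) \<le> card H" using finT by (intro card_mono) auto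
    then show ?thesis using T(2) by linarith
  qed
  ultimately show ?thesis using T(1) by blast
qed

text \<open>The edges from \<open>H\<close> that avoid \<open>F\<close> are counted from \<open>NB K - F\<close> if they start in \<open>K\<close>, and from
  \<open>H - K\<close> otherwise.\<close>

lemma approx_card:
  fixes psi :: real
  assumes "K \<subseteq> H" "H \<subseteq> X" "F \<subseteq> NB K" "0 \<le> psi"
    and H: "\<And>v. v \<in> H \<Longrightarrow> card (nb v - F) \<le> psi"
    and F: "\<And>u. u \<in> Y - F \<Longrightarrow> card (nb u \<inter> H) \<le> psi"
  shows "(d - psi) * (real (card H) - card F) \<le> psi * (real (card (NB K)) - card K)"
proof -
  have KX: "K \<subseteq> X" using assms by blast
  have FY: "F \<subseteq> Y" using assms(3) NB_X[OF KX] by blast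
  note fin = finite_sub_X[OF assms(2)] finite_sub_X[OF KX] finite_sub_Y[OF FY] finite_NB[OF KX]
  have degle: "card (nb u \<inter> Z) \<le> d" if "u \<in> X \<union> Y" for u Z
    using that deg[of u] card_mono[OF fin_nb[of u], of "nb u \<inter> Z"] by auto
  have dsplit: "card (nb v \<inter> F) + card (nb v - F) = d" if "v \<in> X" for v
    using card_Int_plus_Diff[of "nb v" F] deg[of v] fin_nb[of v] that by simp
  have "real d * card H = (\<Sum>v\<in>H. real (card (nb v \<inter> F)) + real (card (nb v - F)))"
    using dsplit assms(2) by (simp add: subset_iff flip: of_nat_add)
  also have "\<dots> = (\<Sum>v\<in>H. real (card (nb v \<inter> F))) + (\<Sum>v\<in>K. real (card (nb v - F)))
      + (\<Sum>v\<in>H - K. real (card (nb v - F)))"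
    using sum.subset_diff[OF assms(1) fin(1), of "\<lambda>v. real (card (nb v - F))"]
    by (simp add: sum.distrib)
  also have "(\<Sum>v\<in>H. real (card (nb v \<inter> F))) = real (\<Sum>u\<in>F. card (nb u \<inter> H))"
    using edge_count[OF assms(2) FY] by (simp flip: of_nat_sum)
  also have "real (\<Sum>u\<in>F. card (nb u \<inter> H)) \<le> real (\<Sum>u\<in>F. d)"
    using degle FY by (intro of_nat_mono sum_mono) auto
  also have "(\<Sum>v\<in>K. real (card (nb v - F))) = (\<Sum>v\<in>K. real (card (nb v \<inter> (NB K - F))))"
  proof (rule sum.cong[OF refl])
    fix v assume "v \<in> K"
    then have "nb v - F = nb v \<inter> (NB K - F)" by (auto simp: NB_def)
    then show "real (card (nb v - F)) = real (card (nb v \<inter> (NB K - F)))" by simp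
  qed
  also have "(\<Sum>v\<in>K. real (card (nb v \<inter> (NB K - F)))) = real (\<Sum>u\<in>NB K - F. card (nb u \<inter> K))"
  proof -
    have "NB K - F \<subseteq> Y" using NB_X[OF KX] by blast
    from edge_count[OF KX this] show ?thesis by (simp flip: of_nat_sum)
  qed
  also have "\<dots> \<le> real (\<Sum>u\<in>NB K - F. card (nb u \<inter> H))"
    using assms(1) NB_X[OF KX] fin(1) by (intro of_nat_mono sum_mono card_mono) auto
  also have "\<dots> \<le> (\<Sum>u\<in>NB K - F. psi)"
    unfolding of_nat_sum using F NB_X[OF KX] by (intro sum_mono) auto
  also have "(\<Sum>v\<in>H - K. real (card (nb v - F))) \<le> (\<Sum>v\<in>H - K. psi)"
    using H by (intro sum_mono) auto
  finally have "real d * card H \<le> real d * card F + psi * (card (NB K - F)) + psi * card (H - K)"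
    by (simp add: mult.commute)
  moreover have "real (card (NB K - F)) = real (card (NB K)) - card F"
    using card_Diff_subset[OF fin(3) assms(3)] card_mono[OF fin(4) assms(3)] by (simp add: of_nat_diff)
  moreover have "real (card (H - K)) = real (card H) - card K"
    using card_Diff_subset[OF fin(2) assms(1)] card_mono[OF fin(1) assms(1)] by (simp add: of_nat_diff)
  ultimately show ?thesis by (simp add: algebra_simps)
qed

text \<open>The closure of \<open>S\<close> is enclosed by \<open>outer\<close> and its neighbourhood encloses \<open>inner\<close>; both
  are determined by the sets \<open>T1\<close> and \<open>T2\<close>, whose number is small because \<open>T1\<close> is connected
  and \<open>T2\<close> lies in a set determined by \<open>T1\<close>.\<close>

lemma closed_approx:
  fixes psi :: real
  assumes "S \<subseteq> X" "conn linked2 S" "0 < psi" "2 * psi \<le> d"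
  shows "\<exists>T1 T2. T1 \<subseteq> X \<and> conn linked4 T1 \<and> psi * card T1 \<le> card (NB S) \<and> card (NB T1) \<le> card (NB S)
    \<and> T2 \<subseteq> NB (near_covered psi T1) \<and> psi * card T2 \<le> 2 * card (NB S)
    \<and> S \<subseteq> outer psi T1 T2 \<and> inner psi T1 T2 \<subseteq> NB S \<and> NB S \<subseteq> NB (outer psi T1 T2)
    \<and> (d - psi) * (real (card (outer psi T1 T2)) - card (inner psi T1 T2))
        \<le> psi * (real (card (NB S)) - card (cl S))"
proof -
  let ?K = "cl S" and ?G = "NB S"
  have NBK: "NB ?K = ?G" using assms(1) by (rule NB_cl)
  have finG: "finite ?G" using assms(1) by (rule finite_NB)
  obtain T1 where T1: "T1 \<subseteq> ?K" "conn linked4 T1" "psi * card T1 \<le> card (NB T1)"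
      "\<forall>v\<in>?K. card (nb v - NB T1) < psi"
    using connected_approx[OF cl_subset conn_cl[OF assms(1,2)] assms(3)] assms(3,4) by auto
  have T1X: "T1 \<subseteq> X" using T1(1) cl_subset by blast
  have NT1: "NB T1 \<subseteq> ?G" using NB_mono[OF T1(1)] NBK by simp
  then have cNT1: "card (NB T1) \<le> card ?G" using finG by (intro card_mono)
  obtain T2 where T2: "T2 \<subseteq> (Y - ?G) \<inter> NB (near_covered psi T1)" "psi * card T2 \<le> card (near_covered psi T1)"
      "\<forall>u\<in>Y - ?G. card (nb u \<inter> (near_covered psi T1 - NB T2)) < psi"
    using outside_approx[OF NB_X[OF assms(1)] near_covered_subset assms(3), of psi T1] by blast
  let ?H = "outer psi T1 T2" and ?F = "inner psi T1 T2"
  have KH: "?K \<subseteq> ?H"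
  proof
    fix v assume v: "v \<in> ?K"
    then have "v \<in> near_covered psi T1" using T1(4) cl_subset by (auto simp: near_covered_def)
    moreover have "v \<notin> NB T2" using v T2(1) nb_sym by (auto simp: NB_def cl_def)
    ultimately show "v \<in> ?H" by (simp add: outer_def)
  qed
  have FG: "?F \<subseteq> ?G" using NT1 T2(3) by (force simp: inner_def outer_def)
  have c5: "(d - psi) * (real (card ?H) - card ?F) \<le> psi * (real (card (NB ?K)) - card ?K)"
  proof (rule approx_card[OF KH outer_subset])
    show "?F \<subseteq> NB ?K" using FG NBK by simp
    show "card (nb v - ?F) \<le> psi" if "v \<in> ?H" for v
    proof -
      have "v \<in> X" "card (nb v - NB T1) < psi" using that by (auto simp: outer_def near_covered_def)
      moreover have "card (nb v - ?F) \<le> card (nb v - NB T1)"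
        using fin_nb[of v] \<open>v \<in> X\<close> by (intro card_mono) (auto simp: inner_def)
      ultimately show ?thesis by linarith
    qed
    show "card (nb u \<inter> ?H) \<le> psi" if "u \<in> Y - ?F" for u
      using that by (auto simp: inner_def)
  qed (use assms in auto)
  have c6: "psi * card T2 \<le> 2 * card ?G"
    using T2(2) card_near_covered_le[OF T1X assms(4)] cNT1 by linarith
  have c7: "?G \<subseteq> NB ?H" using NB_mono[OF KH] NBK by simp
  have c8: "S \<subseteq> ?H" using KH subset_cl[OF assms(1)] by blast
  have c9: "psi * card T1 \<le> card ?G" using T1(3) cNT1 by linarith
  have c10: "T2 \<subseteq> NB (near_covered psi T1)" using T2(1) by blast
  show ?thesis
    using T1X T1(2) c9 cNT1 c10 c6 c8 FG c7 c5[unfolded NBK]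
    by (intro exI[of _ T1] exI[of _ T2] conjI)
qed

text \<open>This is \<open>card_subsets_le_powr\<close> with \<open>x = 1 / d ^ 2\<close>, small
  enough that \<open>(1 + x) ^ card V\<close> costs only \<open>exp (2 * g / d)\<close>.\<close>

lemma card_small_subsets:
  fixes k :: real
  assumes "finite V" "card V \<le> 2 * d * g"
  shows "real (card {Q. Q \<subseteq> V \<and> real (card Q) \<le> k}) \<le> d powr (2 * k) * exp (2 * g / d)"
proof -
  let ?x = "1 / real d ^ 2"
  have x: "0 < ?x" "?x \<le> 1" using d_pos by (auto simp: field_simps)
  have "(1 + ?x) ^ card V \<le> exp ?x ^ card V"
    using exp_ge_add_one_self[of ?x] x by (intro power_mono) auto
  also have "\<dots> = exp (card V * ?x)" by (rule exp_of_nat_mult[symmetric])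
  also have "\<dots> \<le> exp (2 * g / d)"
  proof -
    have "card V * ?x \<le> real (2 * d * g) * ?x"
      using assms(2) x by (intro mult_right_mono of_nat_mono) auto
    also have "\<dots> = 2 * g / d" using d_pos by (simp add: power2_eq_square field_simps)
    finally show ?thesis by simp
  qed
  finally have e: "(1 + ?x) ^ card V \<le> exp (2 * g / d)" .
  have eq: "1 / ?x = d powr 2" using d_pos by simp
  have "(1 / ?x) powr k = d powr (2 * k)" unfolding eq by (rule powr_powr)
  then show ?thesis
    using card_subsets_le_powr[OF assms(1) x, of k] mult_left_mono[OF e, of "d powr (2 * k)"] by simp
qed

text \<open>The exponent 8 is 4 from the branching \<open>d ^ 4\<close>, times 2 from the walk
  length.\<close>

lemma card_conn_linked4:
  fixes r :: real
  assumes "0 \<le> r"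
  shows "real (card {T. T \<subseteq> X \<and> conn linked4 T \<and> real (card T) \<le> r}) \<le> card X * d powr (8 * r)"
proof -
  let ?n = "nat \<lfloor>r\<rfloor>"
  have "{T. T \<subseteq> X \<and> conn linked4 T \<and> real (card T) \<le> r} \<subseteq> {T. T \<subseteq> X \<and> conn linked4 T \<and> card T \<le> Suc ?n}"
    by (auto simp: le_nat_floor le_SucI)
  then have "card {T. T \<subseteq> X \<and> conn linked4 T \<and> real (card T) \<le> r}
      \<le> card {T. T \<subseteq> X \<and> conn linked4 T \<and> card T \<le> Suc ?n}"
    using finX by (intro card_mono) auto
  also have "\<dots> \<le> card X * (d ^ 4) ^ (2 * ?n)"
    using card_linked4 linked4_sym linked4_refl by (intro card_conn_sets finX)
  finally have "real (card {T. T \<subseteq> X \<and> conn linked4 T \<and> real (card T) \<le> r}) \<le> real (card X * (d ^ 4) ^ (2 * ?n))"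
    by (rule of_nat_mono)
  also have "\<dots> = card X * d powr (real (8 * ?n))"
    unfolding powr_realpow[OF d_pos[folded of_nat_0_less_iff[where 'a=real]]]
    by (simp flip: power_mult)
  also have "\<dots> \<le> card X * d powr (8 * r)"
    using assms d_pos by (intro mult_left_mono powr_mono) auto
  finally show ?thesis .
qed

text \<open>Either \<open>outer\<close> is already small enough to serve as a container, or \<open>inner\<close> misses so few
  vertices of \<open>NB S\<close> that one can afford to specify them, and then \<open>cl S\<close> is the container.\<close>

lemma container_sum:
  fixes lam psi eta :: real and a g :: nat
  assumes lam: "0 < lam" and psi: "0 < psi" "2 * psi \<le> d" "2 * psi \<le> eta * (d - psi)" and ag: "a \<le> g"
  defines "t \<equiv> real g - real a"
  shows "(\<Sum>S | S \<subseteq> X \<and> conn linked2 S \<and> card (NB S) = g \<and> card (cl S) = a. lam ^ card S)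
    \<le> (card X * d powr (8 * (g / psi))) * ((d powr (2 * (2 * g / psi)) * exp (2 * g / d))
      * ((1 + lam) powr (g - eta * t / 2) + d powr (2 * (eta * t)) * exp (2 * g / d) * (1 + lam) ^ a))"
proof -
  define \<S> where "\<S> = {S. S \<subseteq> X \<and> conn linked2 S \<and> card (NB S) = g \<and> card (cl S) = a}"
  define \<T>1 where "\<T>1 = {T. T \<subseteq> X \<and> conn linked4 T \<and> card T \<le> g / psi \<and> card (NB T) \<le> g}"
  define \<T>2 where "\<T>2 T1 = {T. T \<subseteq> NB (near_covered psi T1) \<and> card T \<le> 2 * g / psi}" for T1
  \<comment> \<open>If \<open>outer\<close> is small, \<open>S\<close> is counted as one of its
    subsets, in \<open>\<A>\<close>. Otherwise \<open>\<Q>\<close> supplies the part of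
    \<open>NB S\<close> missed by \<open>inner\<close>; then \<open>NB S\<close>, and with it
    \<open>cl S\<close>, is known, and \<open>\<B>\<close> keeps a guess only if the resulting
    closure has the prescribed size \<open>a\<close>.\<close>
  define \<A> where "\<A> T1 T2 = (if card (outer psi T1 T2) \<le> g - eta * t / 2 then Pow (outer psi T1 T2) else {})"
    for T1 T2
  define \<Q> where "\<Q> T1 T2 = {Q. Q \<subseteq> NB (outer psi T1 T2) \<and> card Q \<le> eta * t}" for T1 T2
  define \<B> where "\<B> T1 T2 Q = (if card {v\<in>X. nb v \<subseteq> inner psi T1 T2 \<union> Q} = a
      then Pow {v\<in>X. nb v \<subseteq> inner psi T1 T2 \<union> Q} else {})" for T1 T2 Q
  let ?n3 = "d powr (2 * (eta * t)) * exp (2 * g / d)"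
  let ?C = "(1 + lam) powr (g - eta * t / 2) + ?n3 * (1 + lam) ^ a"
  have t0: "0 \<le> t" using ag by (simp add: t_def)
  have cover: "\<S> \<subseteq> (\<Union>T1\<in>\<T>1. \<Union>T2\<in>\<T>2 T1. \<A> T1 T2 \<union> (\<Union>Q\<in>\<Q> T1 T2. \<B> T1 T2 Q))"
  proof
    fix S assume "S \<in> \<S>"
    then have S: "S \<subseteq> X" "conn linked2 S" "card (NB S) = g" "card (cl S) = a" by (auto simp: \<S>_def)
    obtain T1 T2 where T: "T1 \<subseteq> X" "conn linked4 T1" "psi * card T1 \<le> card (NB S)" "card (NB T1) \<le> card (NB S)"
      "T2 \<subseteq> NB (near_covered psi T1)" "psi * card T2 \<le> 2 * card (NB S)"
      "S \<subseteq> outer psi T1 T2" "inner psi T1 T2 \<subseteq> NB S" "NB S \<subseteq> NB (outer psi T1 T2)"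
      "(d - psi) * (real (card (outer psi T1 T2)) - card (inner psi T1 T2))
        \<le> psi * (real (card (NB S)) - card (cl S))"
      using closed_approx[OF S(1,2) psi(1,2)] by (elim exE conjE) rule
    have T12: "T1 \<in> \<T>1" "T2 \<in> \<T>2 T1"
      using T psi S(3) by (auto simp: \<T>1_def \<T>2_def field_simps)
    have "S \<in> \<A> T1 T2 \<union> (\<Union>Q\<in>\<Q> T1 T2. \<B> T1 T2 Q)"
    proof (cases "card (outer psi T1 T2) \<le> g - eta * t / 2")
      case True
      then show ?thesis using T(7) by (simp add: \<A>_def)
    next
      case False
      have dpsi: "0 < d - psi" using psi by simp
      have "(d - psi) * (real (card (outer psi T1 T2)) - card (inner psi T1 T2)) \<le> psi * t"
        using T(10) S by (simp add: t_def)
      \<comment> \<open>By the choice of \<open>psi\<close>, the sizes of \<open>outer\<close> and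
        \<open>inner\<close> differ by at most \<open>eta * t / 2\<close>. As \<open>outer\<close>
        has more than \<open>g - eta * t / 2\<close> elements here, \<open>inner\<close> misses
        fewer than \<open>eta * t\<close> of the \<open>g\<close> elements of
        \<open>NB S\<close>.\<close>
      also have "\<dots> \<le> (eta * (d - psi) / 2) * t"
        using psi(3) t0 by (intro mult_right_mono) auto
      also have "\<dots> = (d - psi) * (eta * t / 2)" by simp
      finally have "real (card (outer psi T1 T2)) - card (inner psi T1 T2) \<le> eta * t / 2"
        using dpsi by (simp only: mult_le_cancel_left_pos)
      with False have F: "g - eta * t < card (inner psi T1 T2)" by simp
      define Q where "Q = NB S - inner psi T1 T2"
      have "card Q = card (NB S) - card (inner psi T1 T2)" "card (inner psi T1 T2) \<le> card (NB S)"
        unfolding Q_def using T(8) finite_NB[OF S(1)]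
        by (auto intro: card_mono card_Diff_subset finite_subset)
      then have "card Q \<le> eta * t" using F S(3) by (simp add: of_nat_diff)
      then have "Q \<in> \<Q> T1 T2" using T(9) by (auto simp: \<Q>_def Q_def)
      moreover have "inner psi T1 T2 \<union> Q = NB S" using T(8) by (auto simp: Q_def)
      then have "S \<in> \<B> T1 T2 Q"
        using S subset_cl[OF S(1)] by (simp add: \<B>_def cl_def)
      ultimately show ?thesis by blast
    qed
    then show "S \<in> (\<Union>T1\<in>\<T>1. \<Union>T2\<in>\<T>2 T1. \<A> T1 T2 \<union> (\<Union>Q\<in>\<Q> T1 T2. \<B> T1 T2 Q))"
      using T12 by blast
  qed
  have finT1: "finite \<T>1" using finX by (auto simp: \<T>1_def)
  have finT2: "finite (\<T>2 T1)" for T1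
    using finite_NB[OF near_covered_subset] by (auto simp: \<T>2_def)
  have finQ: "finite (\<Q> T1 T2)" for T1 T2
    using finite_NB[OF outer_subset] by (auto simp: \<Q>_def)
  have finA: "finite (\<A> T1 T2)" for T1 T2
    using finite_sub_X[OF outer_subset] by (auto simp: \<A>_def)
  have finB: "finite (\<B> T1 T2 Q)" for T1 T2 Q
    using finX by (auto simp: \<B>_def)
  have nn: "0 \<le> lam ^ n" for n using lam by simp
  have sumA: "(\<Sum>S\<in>\<A> T1 T2. lam ^ card S) \<le> (1 + lam) powr (g - eta * t / 2)" for T1 T2
  proof (cases "card (outer psi T1 T2) \<le> g - eta * t / 2")
    case True
    have "(\<Sum>S\<in>\<A> T1 T2. lam ^ card S) = (1 + lam) powr (card (outer psi T1 T2))"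
      using True lam finite_sub_X[OF outer_subset] by (simp add: \<A>_def sum_Pow_power_card powr_realpow)
    also have "\<dots> \<le> (1 + lam) powr (g - eta * t / 2)"
      using True lam by (intro powr_mono) auto
    finally show ?thesis .
  qed (simp add: \<A>_def)
  have sumB: "(\<Sum>S\<in>\<B> T1 T2 Q. lam ^ card S) \<le> (1 + lam) ^ a" for T1 T2 Q
    using finX lam by (auto simp: \<B>_def sum_Pow_power_card)
  have cH1: "card (NB (near_covered psi T1)) \<le> 2 * d * g" if "T1 \<in> \<T>1" for T1
  proof -
    have "card (NB (near_covered psi T1)) \<le> d * card (near_covered psi T1)" by (rule card_NB_le[OF near_covered_subset])
    also have "\<dots> \<le> d * (2 * g)"
      using that card_near_covered_le[OF _ psi(2), of T1] by (intro mult_left_mono) (auto simp: \<T>1_def)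
    finally show ?thesis by simp
  qed
  have inner: "(\<Sum>S\<in>\<A> T1 T2 \<union> (\<Union>Q\<in>\<Q> T1 T2. \<B> T1 T2 Q). lam ^ card S) \<le> ?C"
    if "T1 \<in> \<T>1" for T1 T2
  proof -
    have "card (NB (outer psi T1 T2)) \<le> 2 * d * g"
      using card_mono[OF finite_NB[OF near_covered_subset] NB_mono, of "outer psi T1 T2" psi T1] cH1[OF that]
      by (auto simp: outer_def)
    from card_small_subsets[OF finite_NB[OF outer_subset] this, of "eta * t"]
    have cQ: "real (card (\<Q> T1 T2)) \<le> ?n3" by (simp add: \<Q>_def)
    have "(\<Sum>S\<in>(\<Union>Q\<in>\<Q> T1 T2. \<B> T1 T2 Q). lam ^ card S) \<le> card (\<Q> T1 T2) * (1 + lam) ^ a"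
      using finQ finB nn sumB by (intro sum_UNION_le_mult)
    also have "\<dots> \<le> ?n3 * (1 + lam) ^ a"
      using cQ lam by (intro mult_right_mono) auto
    finally have "(\<Sum>S\<in>(\<Union>Q\<in>\<Q> T1 T2. \<B> T1 T2 Q). lam ^ card S) \<le> ?n3 * (1 + lam) ^ a" .
    moreover have "(\<Sum>S\<in>\<A> T1 T2 \<union> (\<Union>Q\<in>\<Q> T1 T2. \<B> T1 T2 Q). lam ^ card S)
      \<le> (\<Sum>S\<in>\<A> T1 T2. lam ^ card S) + (\<Sum>S\<in>(\<Union>Q\<in>\<Q> T1 T2. \<B> T1 T2 Q). lam ^ card S)"
      using finA finB finQ nn by (simp add: sum_Un sum_nonneg)
    ultimately show ?thesis using sumA[of T1 T2] by linarith
  qed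
  have C0: "0 \<le> ?C" using lam by simp
  have "(\<Sum>S\<in>\<S>. lam ^ card S)
    \<le> (\<Sum>S\<in>(\<Union>T1\<in>\<T>1. \<Union>T2\<in>\<T>2 T1. \<A> T1 T2 \<union> (\<Union>Q\<in>\<Q> T1 T2. \<B> T1 T2 Q)). lam ^ card S)"
    using cover finT1 finT2 finQ finA finB nn by (intro sum_mono2) auto
  also have "\<dots> \<le> card \<T>1 * ((d powr (2 * (2 * g / psi)) * exp (2 * g / d)) * ?C)"
  proof (rule sum_UNION_le_mult)
    fix T1 assume T1: "T1 \<in> \<T>1"
    have "(\<Sum>S\<in>(\<Union>T2\<in>\<T>2 T1. \<A> T1 T2 \<union> (\<Union>Q\<in>\<Q> T1 T2. \<B> T1 T2 Q)). lam ^ card S)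
        \<le> card (\<T>2 T1) * ?C"
      using finT2 finQ finA finB nn inner[OF T1] by (intro sum_UNION_le_mult) auto
    also have "\<dots> \<le> (d powr (2 * (2 * g / psi)) * exp (2 * g / d)) * ?C"
      using card_small_subsets[OF finite_NB[OF near_covered_subset] cH1[OF T1], of "2 * g / psi"] C0
      by (intro mult_right_mono) (auto simp: \<T>2_def)
    finally show "(\<Sum>S\<in>(\<Union>T2\<in>\<T>2 T1. \<A> T1 T2 \<union> (\<Union>Q\<in>\<Q> T1 T2. \<B> T1 T2 Q)). lam ^ card S)
        \<le> (d powr (2 * (2 * g / psi)) * exp (2 * g / d)) * ?C" .
  qed (use finT1 finT2 finQ finA finB nn in auto)
  also have "\<dots> \<le> (card X * d powr (8 * (g / psi))) * ((d powr (2 * (2 * g / psi)) * exp (2 * g / d)) * ?C)"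
  proof (rule mult_right_mono)
    have "card \<T>1 \<le> card {T. T \<subseteq> X \<and> conn linked4 T \<and> real (card T) \<le> g / psi}"
      using finX by (intro card_mono) (auto simp: \<T>1_def)
    then have "real (card \<T>1) \<le> real (card {T. T \<subseteq> X \<and> conn linked4 T \<and> real (card T) \<le> g / psi})"
      by (rule of_nat_mono)
    also have "\<dots> \<le> card X * d powr (8 * (g / psi))"
      by (rule card_conn_linked4) (use psi(1) in simp)
    finally show "card \<T>1 \<le> card X * d powr (8 * (g / psi))" .
  qed (use C0 in auto)
  finally show ?thesis unfolding \<S>_def .
qed

end

section \<open>Sums over connected sets\<close>

text \<open>The codegree bound makes small sets expand by a factor of order \<open>d\<close>;
  \<open>iso\<close> covers sets of up to half the size of \<open>X\<close>. Both assumptions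
  concern \<open>X\<close> only.\<close>

locale iso_bireg = bireg +
  assumes codeg: "x \<in> X \<Longrightarrow> y \<in> X \<Longrightarrow> x \<noteq> y \<Longrightarrow> card (nb x \<inter> nb y) \<le> 2"
    and iso: "S \<subseteq> X \<Longrightarrow> 2 * card S \<le> card X \<Longrightarrow>
      real (card S) \<le> 2 * sqrt d * (real (card (NB S)) - real (card S))"
begin

text \<open>Vertices are added one at a time. A new vertex shares at most two neighbours with each
  earlier one, and these losses add up to \<open>card S * (card S - 1)\<close>.\<close>

lemma card_NB_ge:
  assumes "S \<subseteq> X"
  shows "real (card S) * d - real (card S) * (real (card S) - 1) \<le> card (NB S)"
  using finite_sub_X[OF assms] assms
proof (induction S rule: finite_induct)
  case (insert v S)
  have v: "v \<in> X" and S: "S \<subseteq> X" using insert.prems by auto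
  have "nb v \<inter> NB S = (\<Union>w\<in>S. nb v \<inter> nb w)" by (auto simp: NB_def)
  moreover have "card (\<Union>w\<in>S. nb v \<inter> nb w) \<le> card S * 2"
    using insert.hyps v S by (intro card_UNION_le_mult codeg) auto
  ultimately have "card (nb v \<inter> NB S) \<le> 2 * card S" by simp
  moreover have "card (nb v \<inter> NB S) + card (nb v - NB S) = d"
    using card_Int_plus_Diff[of "nb v" "NB S"] deg fin_nb v by simp
  moreover have "card (NB (insert v S)) = card (nb v - NB S) + card (NB S)"
  proof -
    have "NB (insert v S) = (nb v - NB S) \<union> NB S" by (auto simp: NB_insert)
    then show ?thesis using card_Un_disjoint[of "nb v - NB S" "NB S"] fin_nb v finite_NB[OF S] by auto
  qed
  ultimately have "real (card (NB S)) + d - 2 * card S \<le> card (NB (insert v S))" by linarith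
  moreover have "real (card S) * d - real (card S) * (real (card S) - 1) \<le> card (NB S)"
    using insert.IH S by blast
  ultimately show ?case using insert.hyps by (simp add: algebra_simps)
qed simp

text \<open>\<open>card_NB_ge\<close> is applied to a subset of size
  \<open>j = (d + 1) div 2\<close>, where \<open>j * d - j * (j - 1)\<close> is largest.\<close>

lemma card_NB_ge_quadratic:
  assumes "S \<subseteq> X" "d \<le> 2 * card S"
  shows "real d ^ 2 / 4 \<le> card (NB S)"
proof -
  define j where "j = (d + 1) div 2"
  have "j \<le> card S" using assms(2) by (simp add: j_def)
  then obtain S' where S': "S' \<subseteq> S" "card S' = j"
    using obtain_subset_with_card_n by metis
  have "real d ^ 2 \<le> 4 * (real j * d - real j * (real j - 1))"
  proof -
    have "d = 2 * j \<or> d + 1 = 2 * j" unfolding j_def by presburger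
    then consider "real d = 2 * real j" | "real d = 2 * real j - 1" by linarith
    then show ?thesis
    proof cases
      case 1
      show ?thesis unfolding 1 by (simp add: power2_eq_square algebra_simps)
    next
      case 2
      have "1 \<le> real j" using d_pos by (simp add: j_def)
      then show ?thesis unfolding 2 by (simp add: power2_eq_square algebra_simps)
    qed
  qed
  also have "\<dots> \<le> 4 * card (NB S')"
    using card_NB_ge[OF order_trans[OF S'(1) assms(1)]] S'(2) by simp
  also have "\<dots> \<le> 4 * real (card (NB S))"
    using card_mono[OF finite_NB[OF assms(1)] NB_mono[OF S'(1)]] by simp
  finally show ?thesis by simp
qed

text \<open>The container bound with \<open>psi = eta * d / 4\<close>. Choosing \<open>T1\<close>
  and \<open>T2\<close> costs \<open>12 / psi * ln d\<close> per vertex of \<open>NB S\<close> in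
  the exponent, from 8 and 4. Condition \<open>c2\<close> bounds the second container term by the
  gain \<open>exp (- L * eta * t / 2)\<close> of the first, up to a factor
  \<open>exp (2 * g / d)\<close>; \<open>c1\<close> keeps all costs below half of that gain.\<close>

lemma sum_of_size:
  fixes lam eta :: real
  assumes lam: "0 < lam" and eta: "0 < eta" "eta \<le> 1"
    and c1: "48 * ln d / (eta * d) + 4 / d \<le> ln (1 + lam) * eta / (12 * sqrt d)"
    and c2: "2 * eta * ln d + ln (1 + lam) * eta / 2 \<le> ln (1 + lam)"
    and a: "a \<le> g" "real g - a \<ge> g / (3 * sqrt d)"
  shows "(\<Sum>S | S \<subseteq> X \<and> conn linked2 S \<and> card (NB S) = g \<and> card (cl S) = a.
      lam ^ card S / (1 + lam) ^ card (NB S))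
    \<le> 2 * card X * exp (- (ln (1 + lam) / 12 * (eta / sqrt d) * g))"
proof -
  define L D psi t where "L = ln (1 + lam)" and "D = ln (real d)" and "psi = eta * d / 4"
    and "t = real g - real a"
  have d: "0 < real d" using d_pos by simp
  have L: "0 < L" using lam by (simp add: L_def)
  have t: "0 \<le> t" "g / (3 * sqrt d) \<le> t" using a by (auto simp: t_def)
  have ed: "eta * real d \<le> 1 * real d" "eta * (eta * real d) \<le> 1 * (eta * real d)"
    by (rule mult_right_mono; use eta d in simp)+
  have psi: "0 < psi" "2 * psi \<le> d" "2 * psi \<le> eta * (d - psi)"
  proof -
    have "eta * (real d - eta * real d / 4) = eta * real d - eta * (eta * real d) / 4"
      by (simp add: algebra_simps)
    moreover have "0 < eta * real d" using eta d by simp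
    ultimately show "0 < psi" "2 * psi \<le> d" "2 * psi \<le> eta * (d - psi)"
      using ed unfolding psi_def by linarith+
  qed
  let ?E = "\<lambda>x::real. exp (L * x)"
  have "(\<Sum>S | S \<subseteq> X \<and> conn linked2 S \<and> card (NB S) = g \<and> card (cl S) = a.
      lam ^ card S / (1 + lam) ^ card (NB S))
    = (\<Sum>S | S \<subseteq> X \<and> conn linked2 S \<and> card (NB S) = g \<and> card (cl S) = a. lam ^ card S) * (1 + lam) powr (-g)"
    unfolding sum_distrib_right using lam
    by (intro sum.cong) (auto simp: powr_minus powr_realpow divide_inverse)
  also have "\<dots> \<le> ((card X * d powr (8 * (g / psi))) * ((d powr (2 * (2 * g / psi)) * exp (2 * g / d))
      * ((1 + lam) powr (g - eta * t / 2) + d powr (2 * (eta * t)) * exp (2 * g / d) * (1 + lam) ^ a)))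
      * (1 + lam) powr (-g)"
    unfolding t_def by (intro mult_right_mono container_sum[OF lam psi a(1)]) auto
  also have "\<dots> = card X * (exp (12 * D / psi * g + 2 * g / d)
      * (exp (- L * eta * t / 2) + exp (2 * eta * t * D + 2 * g / d - L * t)))"
  proof -
    have a_eq: "real a = g - t" by (simp add: t_def)
    have "(1 + lam) ^ a = exp (L * (g - t))"
      using lam unfolding a_eq[symmetric] by (simp add: powr_def L_def mult.commute flip: powr_realpow)
    moreover have "(1 + lam) powr x = exp (L * x)" for x
      using lam by (simp add: powr_def L_def mult.commute)
    moreover have "d powr x = exp (D * x)" for x
      using d_pos by (simp add: powr_def D_def mult.commute)
    ultimately show ?thesis
      by (simp add: algebra_simps flip: exp_add)
  qed
  also have "\<dots> \<le> card X * (exp (12 * D / psi * g + 2 * g / d)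
      * (exp (- L * eta * t / 2 + 2 * g / d) + exp (- L * eta * t / 2 + 2 * g / d)))"
  proof -
    have "(2 * eta * D + L * eta / 2) * t \<le> L * t"
      using c2 t by (intro mult_right_mono) (auto simp: L_def D_def)
    then have "2 * eta * t * D - L * t \<le> - L * eta * t / 2" by (simp add: algebra_simps)
    then show ?thesis by (intro mult_left_mono add_mono) auto
  qed
  also have "\<dots> = 2 * card X * exp ((12 * D / psi + 4 / d) * g - L * eta * t / 2)"
    by (simp add: algebra_simps flip: exp_add)
  also have "\<dots> \<le> 2 * card X * exp (- (L / 12 * (eta / sqrt d) * g))"
  proof -
    have "12 * D / psi + 4 / d = 48 * D / (eta * d) + 4 / d"
      using eta d by (simp add: psi_def field_simps)
    also have "\<dots> \<le> L * eta / (12 * sqrt d)" using c1 by (simp add: L_def D_def)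
    finally have "(12 * D / psi + 4 / d) * g \<le> L * eta / (12 * sqrt d) * g"
      by (intro mult_right_mono) auto
    moreover have "L * eta / 2 * (g / (3 * sqrt d)) \<le> L * eta / 2 * t"
      using t L eta by (intro mult_left_mono) auto
    ultimately have "(12 * D / psi + 4 / d) * g - L * eta * t / 2 \<le> - (L / 12 * (eta / sqrt d) * g)"
      by (simp add: field_simps)
    then show ?thesis by (intro mult_left_mono) auto
  qed
  finally show ?thesis unfolding L_def .
qed

text \<open>The sets are grouped by the sizes \<open>a\<close> and \<open>g\<close> of closure and
  neighbourhood. There are few such pairs, isoperimetry of the closure makes \<open>g - a\<close>
  large, and \<open>g \<ge> d ^ 2 / 4\<close> makes every group small enough.\<close>

lemma big_sum:
  fixes lam eta :: real
  assumes lam: "0 < lam" and eta: "0 < eta" "eta \<le> 1"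
    and c1: "48 * ln d / (eta * d) + 4 / d \<le> ln (1 + lam) * eta / (12 * sqrt d)"
    and c2: "2 * eta * ln d + ln (1 + lam) * eta / 2 \<le> ln (1 + lam)"
  shows "(\<Sum>S | S \<subseteq> X \<and> conn linked2 S \<and> d \<le> 2 * card S \<and> 2 * card (cl S) \<le> card X.
      lam ^ card S / (1 + lam) ^ card (NB S))
    \<le> 2 * (real (card X) + 1) ^ 3 * exp (- (ln (1 + lam) / 48 * eta * (real d ^ 2 / sqrt d)))"
proof -
  let ?f = "\<lambda>S. lam ^ card S / (1 + lam) ^ card (NB S)"
  let ?S = "{S. S \<subseteq> X \<and> conn linked2 S \<and> d \<le> 2 * card S \<and> 2 * card (cl S) \<le> card X}"
  let ?J = "{p. fst p \<le> card X \<and> snd p \<le> card X \<and> fst p \<le> snd p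
      \<and> real (snd p) - real (fst p) \<ge> real (snd p) / (3 * sqrt d) \<and> real d ^ 2 / 4 \<le> real (snd p)}"
  let ?P = "\<lambda>p. {S. S \<subseteq> X \<and> conn linked2 S \<and> card (NB S) = snd p \<and> card (cl S) = fst p}"
  let ?e = "exp (- (ln (1 + lam) / 48 * eta * (real d ^ 2 / sqrt d)))"
  let ?c = "2 * card X * ?e"
  have d: "1 \<le> sqrt (real d)" using d_pos by simp
  have cover: "?S \<subseteq> (\<Union>p\<in>?J. ?P p)"
  proof
    fix S assume "S \<in> ?S"
    then have S: "S \<subseteq> X" "conn linked2 S" "d \<le> 2 * card S" "2 * card (cl S) \<le> card X" by auto
    let ?a = "card (cl S)" and ?g = "card (NB S)"
    have ga: "?g \<le> card X" "?a \<le> card X" "?a \<le> ?g"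
      using card_mono[OF finY NB_X[OF S(1)]] card_mono[OF finX cl_subset] card_eq
        card_le_card_NB[OF cl_subset, of S] NB_cl[OF S(1)] by auto
    \<comment> \<open>The 3 is 2 from the isoperimetric bound on \<open>?a\<close> plus 1 for
      passing from \<open>?a\<close> to \<open>?g\<close>.\<close>
    have "?a \<le> 2 * sqrt d * (real ?g - ?a)"
      using iso[OF cl_subset S(4)] NB_cl[OF S(1)] by simp
    moreover have "1 * (real ?g - ?a) \<le> sqrt d * (real ?g - ?a)"
      using ga d by (intro mult_right_mono) auto
    ultimately have "?g \<le> (real ?g - ?a) * (3 * sqrt d)" by (simp add: algebra_simps)
    then have "real ?g - ?a \<ge> ?g / (3 * sqrt d)" using d by (simp add: pos_divide_le_eq)
    moreover have "real d ^ 2 / 4 \<le> ?g" using card_NB_ge_quadratic S by blast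
    ultimately have "(?a, ?g) \<in> ?J" "S \<in> ?P (?a, ?g)" using ga S by auto
    then show "S \<in> (\<Union>p\<in>?J. ?P p)" by blast
  qed
  have Jsub: "?J \<subseteq> {..card X} \<times> {..card X}" by auto
  then have finJ: "finite ?J" by (rule finite_subset) auto
  have "card ?J \<le> card ({..card X} \<times> {..card X})" by (rule card_mono[OF _ Jsub]) auto
  then have cJ: "card ?J \<le> (card X + 1) ^ 2" by (simp add: power2_eq_square)
  have "(\<Sum>S\<in>?S. ?f S) \<le> (\<Sum>S\<in>(\<Union>p\<in>?J. ?P p). ?f S)"
    using finJ finX lam by (intro sum_mono2 cover) auto
  also have "\<dots> \<le> card ?J * ?c"
  proof (rule sum_UNION_le_mult[OF finJ])
    fix p assume p: "p \<in> ?J"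
    have "(\<Sum>S\<in>?P p. ?f S) \<le> 2 * card X * exp (- (ln (1 + lam) / 12 * (eta / sqrt d) * snd p))"
      using p by (intro sum_of_size[OF lam eta c1 c2]) auto
    also have "\<dots> \<le> ?c"
    proof -
      have "ln (1 + lam) / 12 * (eta / sqrt d) * (real d ^ 2 / 4) \<le> ln (1 + lam) / 12 * (eta / sqrt d) * snd p"
        using p eta lam by (intro mult_left_mono) auto
      then show ?thesis by (intro mult_left_mono) (auto simp: field_simps)
    qed
    finally show "(\<Sum>S\<in>?P p. ?f S) \<le> ?c" .
  qed (use finX lam in auto)
  also have "\<dots> \<le> (real (card X) + 1) ^ 2 * ?c"
    using of_nat_mono[OF cJ, where 'a=real] by (intro mult_right_mono) (auto simp: add.commute)
  also have "\<dots> \<le> 2 * (real (card X) + 1) ^ 2 * ?e * (real (card X) + 1)"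
    by (simp add: mult_ac)
  finally show ?thesis by (simp add: power3_eq_cube power2_eq_square mult_ac)
qed

text \<open>A set of size \<open>j\<close> in this range has at least \<open>d + j * d / 4\<close>
  neighbours, and there are at most \<open>card X * d ^ (4 * j)\<close> such sets. With the factor
  \<open>j\<close> bounded by \<open>2 ^ j\<close>, size \<open>j\<close> contributes at most
  \<open>r ^ j \<le> r ^ 2\<close> times \<open>card X / (1 + lam) ^ d\<close>.\<close>

lemma small_sum:
  fixes lam r :: real
  assumes lam: "0 < lam" "lam \<le> 1"
  defines "r \<equiv> 2 * real d ^ 4 * (1 + lam) powr (- (real d / 4))"
  assumes r: "r \<le> 1"
  shows "(\<Sum>S | S \<subseteq> X \<and> conn linked2 S \<and> 2 \<le> card S \<and> 2 * card S < d.
      card S * (lam ^ card S / (1 + lam) ^ card (NB S)))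
    \<le> card X / (1 + lam) ^ d * (d * r ^ 2)"
proof -
  let ?f = "\<lambda>S. card S * (lam ^ card S / (1 + lam) ^ card (NB S))"
  let ?S = "{S. S \<subseteq> X \<and> conn linked2 S \<and> 2 \<le> card S \<and> 2 * card S < d}"
  let ?J = "{j. 2 \<le> j \<and> 2 * j < d}"
  let ?P = "\<lambda>j. {S. S \<subseteq> X \<and> conn linked2 S \<and> card S = j}"
  let ?c = "card X / (1 + lam) ^ d * r ^ 2"
  have r0: "0 \<le> r" by (simp add: r_def)
  have finJ: "finite ?J" by (rule finite_subset[of _ "{..<d}"]) auto
  have "(\<Sum>S\<in>?S. ?f S) \<le> (\<Sum>S\<in>(\<Union>j\<in>?J. ?P j). ?f S)"
    using finJ finX lam by (intro sum_mono2) auto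
  also have "\<dots> \<le> card ?J * ?c"
  proof (rule sum_UNION_le_mult[OF finJ])
    fix j assume j: "j \<in> ?J"
    have jd: "2 \<le> real j" "2 * real j \<le> d" using j by auto
    let ?w = "2 ^ j * ((1 + lam) powr (- (real d + j * (real d / 4))))"
    have "card (?P j) \<le> card {S. S \<subseteq> X \<and> conn linked2 S \<and> card S \<le> Suc (j - 1)}"
      using finX by (intro card_mono) auto
    also have "\<dots> \<le> card X * (d ^ 2) ^ (2 * (j - 1))"
      using card_linked2 linked2_sym linked2_refl by (intro card_conn_sets finX)
    also have "\<dots> \<le> card X * (d ^ 4) ^ j"
      using d_pos by (simp add: power_increasing flip: power_mult)
    finally have cP: "real (card (?P j)) \<le> card X * (real d ^ 4) ^ j"
      by (metis of_nat_le_iff of_nat_mult of_nat_power)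
    have "?f S \<le> ?w" if "S \<in> ?P j" for S
    proof -
      have S: "S \<subseteq> X" "card S = j" using that by auto
      have "real d + j * (real d / 4) \<le> real j * d - real j * (real j - 1)"
      proof -
        have "real j / 2 * (real d / 2) \<le> (real j - 1) * (real d - j)"
          using jd by (intro mult_mono) auto
        then show ?thesis by (simp add: algebra_simps)
      qed
      also have "\<dots> \<le> card (NB S)" using card_NB_ge[OF S(1)] S(2) by simp
      finally have le: "real d + j * (real d / 4) \<le> card (NB S)" .
      have "?f S = (real j * lam ^ j) * (1 + lam) powr (- real (card (NB S)))"
        using lam S by (simp add: powr_minus powr_realpow divide_inverse)
      also have "\<dots> \<le> (2 ^ j * 1) * (1 + lam) powr (- (real d + j * (real d / 4)))"
        using lam le of_nat_less_two_power[of j, where 'a=real]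
        by (intro mult_mono powr_mono power_le_one) auto
      finally show ?thesis by simp
    qed
    then have "(\<Sum>S\<in>?P j. ?f S) \<le> (\<Sum>S\<in>?P j. ?w)" by (intro sum_mono)
    also have "\<dots> = card (?P j) * ?w" by simp
    also have "\<dots> \<le> (card X * (real d ^ 4) ^ j) * ?w"
      using cP by (intro mult_right_mono) auto
    also have "\<dots> = card X / (1 + lam) ^ d * r ^ j"
    proof -
      have "(1 + lam) powr (- (real d + j * (real d / 4)))
          = (1 + lam) powr (- real d) * ((1 + lam) powr (- (real d / 4))) ^ j"
        using lam by (simp add: powr_add[symmetric] powr_power algebra_simps)
      moreover have "(1 + lam) powr (- real d) = 1 / (1 + lam) ^ d"
        using lam by (simp add: powr_minus powr_realpow divide_inverse)
      ultimately show ?thesis unfolding r_def power_mult_distrib by simp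
    qed
    also have "\<dots> \<le> ?c"
      using lam r r0 j by (intro mult_left_mono power_decreasing) auto
    finally show "(\<Sum>S\<in>?P j. ?f S) \<le> ?c" .
  qed (use finX lam in auto)
  also have "\<dots> \<le> d * ?c"
  proof (rule mult_right_mono)
    have "card ?J \<le> card {..<d}" by (rule card_mono) auto
    then show "real (card ?J) \<le> d" by simp
  qed (use lam in auto)
  finally show ?thesis by (simp add: mult_ac)
qed

end

section \<open>Hard-core weights\<close>

context bireg
begin

definition indeps :: "'a set set" where
  "indeps = {I. I \<subseteq> X \<union> Y \<and> (\<forall>x\<in>I. nb x \<inter> I = {})}"

text \<open>Unnormalised probability; \<open>total lam\<close> is the partition function.\<close>

definition weight :: "real \<Rightarrow> ('a set \<Rightarrow> bool) \<Rightarrow> real" where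
  "weight lam P = (\<Sum>I | I \<in> indeps \<and> P I. lam ^ card I)"

abbreviation total :: "real \<Rightarrow> real" where
  "total lam \<equiv> weight lam (\<lambda>_. True)"

lemma finite_indeps: "finite indeps"
  by (rule finite_subset[of _ "Pow (X \<union> Y)"]) (use finX finY in \<open>auto simp: indeps_def\<close>)

lemma finite_indeps_Collect [simp]: "finite {I. I \<in> indeps \<and> P I}"
  using finite_indeps by simp

lemma weight_nonneg: "0 \<le> lam \<Longrightarrow> 0 \<le> weight lam P"
  unfolding weight_def by (intro sum_nonneg) auto

lemma total_pos: "0 < lam \<Longrightarrow> 0 < total lam"
  unfolding weight_def using finite_indeps
  by (intro sum_pos2[of _ "{}"]) (auto simp: indeps_def)

lemma weight_mono:
  assumes "0 \<le> lam" "\<And>I. I \<in> indeps \<Longrightarrow> P I \<Longrightarrow> Q I"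
  shows "weight lam P \<le> weight lam Q"
  unfolding weight_def using assms by (intro sum_mono2) auto

lemma weight_disj:
  assumes "0 \<le> lam"
  shows "weight lam (\<lambda>I. P I \<or> Q I) \<le> weight lam P + weight lam Q"
proof -
  have "{I. I \<in> indeps \<and> (P I \<or> Q I)} = {I. I \<in> indeps \<and> P I} \<union> {I. I \<in> indeps \<and> Q I}" by blast
  then show ?thesis unfolding weight_def using assms by (simp add: sum_Un sum_nonneg)
qed

lemma weight_eq_sum_of_bool: "weight lam P = (\<Sum>I\<in>indeps. lam ^ card I * of_bool (P I))"
  unfolding weight_def using finite_indeps by (intro sum.mono_neutral_cong_left) auto

lemma weight_Bex:
  assumes "0 \<le> lam" "finite J"
  shows "weight lam (\<lambda>I. \<exists>S\<in>J. P S I) \<le> (\<Sum>S\<in>J. weight lam (P S))"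
  using assms(2)
proof (induction J rule: finite_induct)
  case (insert S J)
  have "weight lam (\<lambda>I. \<exists>T\<in>insert S J. P T I) \<le> weight lam (\<lambda>I. P S I \<or> (\<exists>T\<in>J. P T I))"
    using assms(1) by (intro weight_mono) auto
  then show ?case using weight_disj[OF assms(1), of "P S" "\<lambda>I. \<exists>T\<in>J. P T I"] insert by simp
qed (simp add: weight_def)

subsection \<open>Removing a separated piece\<close>

text \<open>For \<open>S \<subseteq> X\<close> this says that \<open>S\<close> is a union of
  2-linked components of \<open>I \<inter> X\<close>.\<close>

definition sep :: "'a set \<Rightarrow> 'a set \<Rightarrow> bool" where
  "sep S I \<longleftrightarrow> S \<subseteq> I \<and> NB S \<inter> NB (I \<inter> X - S) = {}"

text \<open>Replacing \<open>S\<close> by an arbitrary subset of \<open>NB S\<close> keeps the set independent, and the original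
  set can be recovered from the result.\<close>

lemma weight_sep_le:
  assumes lam: "0 < lam" and S: "S \<subseteq> X"
  shows "weight lam (sep S) \<le> lam ^ card S / (1 + lam) ^ card (NB S) * total lam"
proof -
  let ?E = "{I. I \<in> indeps \<and> sep S I}"
  define \<phi> where "\<phi> = (\<lambda>(I, R). (I - S) \<union> R :: 'a set)"
  have NBY: "NB S \<subseteq> Y" using NB_X[OF S] .
  have *: "R \<inter> X = {}" "I \<inter> NB S = {}" "R \<inter> S = {}" "R \<inter> I = {}" "S \<subseteq> I"
    if "I \<in> ?E" "R \<subseteq> NB S" for I R
  proof -
    show "R \<inter> X = {}" using that NBY disjoint by blast
    show "S \<subseteq> I" using that by (simp add: sep_def)
    show I: "I \<inter> NB S = {}" using that by (auto simp: sep_def indeps_def NB_def)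
    show "R \<inter> S = {}" using that NBY disjoint S by blast
    show "R \<inter> I = {}" using that I by blast
  qed
  have inj: "inj_on \<phi> (?E \<times> Pow (NB S))"
  proof (rule inj_onI, clarify)
    fix I R I' R'
    assume a: "I \<in> indeps" "sep S I" "R \<subseteq> NB S" "I' \<in> indeps" "sep S I'" "R' \<subseteq> NB S"
      and e: "\<phi> (I, R) = \<phi> (I', R')"
    have e': "(I - S) \<union> R = (I' - S) \<union> R'" using e by (simp add: \<phi>_def)
    have i: "I \<inter> NB S = {}" "S \<subseteq> I" "I' \<inter> NB S = {}" "S \<subseteq> I'" "R \<inter> S = {}" "R' \<inter> S = {}"
      using *[of I R] *[of I' R'] a by blast+
    have "R = ((I - S) \<union> R) \<inter> NB S" "R' = ((I' - S) \<union> R') \<inter> NB S" using i a by blast+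
    then have "R = R'" using e' by simp
    moreover have "I = ((I - S) \<union> R - NB S) \<union> S" "I' = ((I' - S) \<union> R' - NB S) \<union> S"
      using i a by blast+
    then have "I = I'" using e' by simp
    ultimately show "I = I' \<and> R = R'" by simp
  qed
  have img: "\<phi> ` (?E \<times> Pow (NB S)) \<subseteq> indeps"
  proof clarify
    fix I R assume a: "I \<in> indeps" "sep S I" "R \<subseteq> NB S"
    have "nb x \<inter> ((I - S) \<union> R) = {}" if x: "x \<in> (I - S) \<union> R" for x
    proof -
      have sepI: "NB S \<inter> NB (I \<inter> X - S) = {}" using a(2) by (simp add: sep_def)
      have IXY: "I \<subseteq> X \<union> Y" using a(1) by (simp add: indeps_def)
      have noRI: False if "u \<in> R" "w \<in> I - S" "u \<in> nb w" for u w
      proof -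
        have "u \<in> Y" using that(1) a(3) NBY by blast
        then have "w \<in> X" using that(3) nb_sym[of u w] nbY by blast
        then have "u \<in> NB (I \<inter> X - S)" using that by (auto simp: NB_def)
        then show False using sepI that(1) a(3) by blast
      qed
      have noRR: False if "u \<in> R" "w \<in> R" "u \<in> nb w" for u w
        using that a(3) NBY nbY[of w] disjoint by blast
      have noII: False if "u \<in> I" "w \<in> I" "u \<in> nb w" for u w
        using that a(1) by (auto simp: indeps_def)
      show ?thesis using x noRI noRR noII nb_sym by blast
    qed
    moreover have "(I - S) \<union> R \<subseteq> X \<union> Y" using a NBY by (auto simp: indeps_def)
    ultimately show "\<phi> (I, R) \<in> indeps" by (simp add: indeps_def \<phi>_def)
  qed
  have "weight lam (sep S) * (1 + lam) ^ card (NB S) = (\<Sum>I\<in>?E. lam ^ card I) * (\<Sum>R\<in>Pow (NB S). lam ^ card R)"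
    using finite_NB[OF S] by (simp add: weight_def sum_Pow_power_card)
  also have "\<dots> = (\<Sum>p\<in>?E \<times> Pow (NB S). lam ^ card (fst p) * lam ^ card (snd p))"
    by (simp add: sum_product sum.cartesian_product case_prod_beta)
  also have "\<dots> = (\<Sum>p\<in>?E \<times> Pow (NB S). lam ^ card S * lam ^ card (\<phi> p))"
  proof (rule sum.cong[OF refl])
    fix p assume p: "p \<in> ?E \<times> Pow (NB S)"
    obtain I R where IR: "p = (I, R)" "I \<in> ?E" "R \<subseteq> NB S" using p by auto
    have fin: "finite I" "finite R"
      using IR finX finY finite_NB[OF S] finite_subset unfolding indeps_def by blast+
    have "card (\<phi> p) = card (I - S) + card R"
      using *[OF IR(2,3)] fin unfolding \<phi>_def IR by (simp, intro card_Un_disjoint) auto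
    moreover have "card I = card (I - S) + card S"
      using *(5)[OF IR(2,3)] fin card_Int_plus_Diff[of I S] by (simp add: Int_absorb1 add.commute)
    ultimately show "lam ^ card (fst p) * lam ^ card (snd p) = lam ^ card S * lam ^ card (\<phi> p)"
      by (simp add: IR power_add)
  qed
  also have "\<dots> = lam ^ card S * (\<Sum>J\<in>\<phi> ` (?E \<times> Pow (NB S)). lam ^ card J)"
    by (simp add: sum.reindex[OF inj] flip: sum_distrib_left)
  also have "\<dots> \<le> lam ^ card S * (\<Sum>J\<in>indeps. lam ^ card J)"
    using lam by (intro mult_left_mono sum_mono2 finite_indeps img) auto
  also have "\<dots> = lam ^ card S * total lam" by (simp add: weight_def)
  finally show ?thesis using lam by (simp add: field_simps)
qed

subsection \<open>Conditioning on one side\<close>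

text \<open>Once the part \<open>A\<close> in \<open>X\<close> is fixed, the part in
  \<open>Y\<close> may be any set of vertices without neighbour in \<open>A\<close>.\<close>

lemma sum_indeps_split:
  fixes f :: "'a set \<Rightarrow> real"
  shows "(\<Sum>I\<in>indeps. f I) = (\<Sum>A\<in>Pow X. \<Sum>B\<in>Pow (Y - NB A). f (A \<union> B))"
proof -
  have "bij_betw (\<lambda>(A, B). A \<union> B) (SIGMA A:Pow X. Pow (Y - NB A)) indeps"
  proof (rule bij_betw_byWitness[where f' = "\<lambda>I. (I \<inter> X, I \<inter> Y)"])
    show "\<forall>p\<in>SIGMA A:Pow X. Pow (Y - NB A).
        ((case p of (A, B) \<Rightarrow> A \<union> B) \<inter> X, (case p of (A, B) \<Rightarrow> A \<union> B) \<inter> Y) = p"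
      using disjoint by auto
    show "\<forall>I\<in>indeps. (case (I \<inter> X, I \<inter> Y) of (A, B) \<Rightarrow> A \<union> B) = I"
      by (auto simp: indeps_def)
    show "(\<lambda>(A, B). A \<union> B) ` (SIGMA A:Pow X. Pow (Y - NB A)) \<subseteq> indeps"
    proof clarify
      fix A B assume a: "A \<subseteq> X" "B \<subseteq> Y - NB A"
      have "False" if "u \<in> A \<union> B" "w \<in> A \<union> B" "u \<in> nb w" for u w
      proof -
        have "w \<in> A \<Longrightarrow> u \<notin> A" "w \<in> B \<Longrightarrow> u \<notin> B" using that a nbX[of w] nbY[of w] disjoint by blast+
        moreover have "\<not> (w \<in> A \<and> u \<in> B)" using that a by (auto simp: NB_def)
        moreover have "\<not> (w \<in> B \<and> u \<in> A)" using that a nb_sym[of u w] by (auto simp: NB_def)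
        ultimately show False using that by blast
      qed
      then show "A \<union> B \<in> indeps" using a unfolding indeps_def by blast
    qed
    show "(\<lambda>I. (I \<inter> X, I \<inter> Y)) ` indeps \<subseteq> (SIGMA A:Pow X. Pow (Y - NB A))"
      by (auto simp: indeps_def NB_def)
  qed
  then have "(\<Sum>I\<in>indeps. f I) = (\<Sum>p\<in>(SIGMA A:Pow X. Pow (Y - NB A)). f (case p of (A, B) \<Rightarrow> A \<union> B))"
    by (rule sum.reindex_bij_betw[symmetric])
  also have "\<dots> = (\<Sum>A\<in>Pow X. \<Sum>B\<in>Pow (Y - NB A). f (A \<union> B))"
    using finX finY by (subst sum.Sigma) (auto intro!: sum.cong)
  finally show ?thesis .
qed

text \<open>Law of total probability: \<open>(1 + lam) ^ card (Y - NB A)\<close> is the partition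
  function given \<open>I \<inter> X = A\<close>, so the hypothesis bounds each conditional
  probability by \<open>e\<close>.\<close>

lemma weight_conditional_le:
  fixes lam e :: real
  assumes lam: "0 < lam"
    and P: "\<And>A. A \<subseteq> X \<Longrightarrow>
      (\<Sum>B\<in>Pow (Y - NB A). lam ^ card B * of_bool (P A B)) \<le> e * (1 + lam) ^ card (Y - NB A)"
  shows "weight lam (\<lambda>I. P (I \<inter> X) (I \<inter> Y)) \<le> e * total lam"
proof -
  have factor: "(\<Sum>B\<in>Pow (Y - NB A). lam ^ card (A \<union> B) * h (A \<union> B))
      = lam ^ card A * (\<Sum>B\<in>Pow (Y - NB A). lam ^ card B * h (A \<union> B))"
    if "A \<subseteq> X" for A and h :: "'a set \<Rightarrow> real"
  proof -
    have "card (A \<union> B) = card A + card B" if "B \<subseteq> Y - NB A" for B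
      using that \<open>A \<subseteq> X\<close> disjoint finite_sub_X[of A] finite_sub_Y[of B] by (intro card_Un_disjoint) auto
    then show ?thesis unfolding sum_distrib_left
      by (intro sum.cong) (auto simp: power_add)
  qed
  have "weight lam (\<lambda>I. P (I \<inter> X) (I \<inter> Y))
      = (\<Sum>A\<in>Pow X. lam ^ card A * (\<Sum>B\<in>Pow (Y - NB A). lam ^ card B * of_bool (P A B)))"
    unfolding weight_eq_sum_of_bool sum_indeps_split
  proof (rule sum.cong[OF refl])
    fix A assume A: "A \<in> Pow X"
    have "(A \<union> B) \<inter> X = A" "(A \<union> B) \<inter> Y = B" if "B \<subseteq> Y - NB A" for B
      using that A disjoint by auto
    then have "(\<Sum>B\<in>Pow (Y - NB A). lam ^ card B * of_bool (P ((A \<union> B) \<inter> X) ((A \<union> B) \<inter> Y)))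
        = (\<Sum>B\<in>Pow (Y - NB A). lam ^ card B * of_bool (P A B))"
      by (intro sum.cong) auto
    then show "(\<Sum>B\<in>Pow (Y - NB A). lam ^ card (A \<union> B) * of_bool (P ((A \<union> B) \<inter> X) ((A \<union> B) \<inter> Y)))
        = lam ^ card A * (\<Sum>B\<in>Pow (Y - NB A). lam ^ card B * of_bool (P A B))"
      using A by (subst factor) auto
  qed
  also have "\<dots> \<le> (\<Sum>A\<in>Pow X. lam ^ card A * (e * (1 + lam) ^ card (Y - NB A)))"
    using lam P by (intro sum_mono mult_left_mono) auto
  also have "\<dots> = e * (\<Sum>A\<in>Pow X. lam ^ card A * (\<Sum>B\<in>Pow (Y - NB A). lam ^ card B * 1))"
  proof -
    have "(\<Sum>B\<in>Pow (Y - NB A). lam ^ card B * 1) = (1 + lam) ^ card (Y - NB A)" for A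
      using finY by (simp add: sum_Pow_power_card)
    then show ?thesis by (simp only: sum_distrib_left mult.left_commute)
  qed
  also have "\<dots> = e * total lam"
    unfolding weight_eq_sum_of_bool sum_indeps_split using factor[of _ "\<lambda>_. 1"] by simp
  finally show ?thesis .
qed

lemma sum_avoiding:
  fixes lam :: real
  assumes lam: "0 < lam" and "finite D"
  shows "(\<Sum>B\<in>Pow D. lam ^ card B * of_bool (Q \<inter> B = {})) = (1 + lam) ^ card D / (1 + lam) ^ card (Q \<inter> D)"
proof -
  have "(\<Sum>B\<in>Pow D. lam ^ card B * of_bool (Q \<inter> B = {})) = (\<Sum>B\<in>Pow (D - Q). lam ^ card B)"
    using assms(2) by (intro sum.mono_neutral_cong_right) auto
  also have "\<dots> = (1 + lam) ^ card (D - Q)" using assms(2) by (simp add: sum_Pow_power_card)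
  finally show ?thesis
    using card_Int_plus_Diff[OF assms(2), of Q] lam
    by (simp add: Int_commute flip: power_add) (simp add: field_simps flip: power_add)
qed

text \<open>Chebyshev's inequality, where vertices without common neighbour give uncorrelated
  indicators.\<close>

lemma few_free_le:
  fixes lam m0 :: real
  assumes lam: "0 < lam" and D: "D \<subseteq> Y" and X: "X \<noteq> {}"
  defines "m0 \<equiv> card X / (1 + lam) ^ d"
  shows "(\<Sum>B\<in>Pow D. lam ^ card B * of_bool (card (X - NB B) < m0 / 2))
    \<le> 4 * d ^ 2 / m0 * (1 + lam) ^ card D"
proof -
  have finD: "finite D" using D by (rule finite_sub_Y)
  define T where "T = (1 + lam) ^ card D"
  \<comment> \<open>\<open>q v\<close> is the probability that a random subset of \<open>D\<close>
    avoids \<open>nb v\<close>; \<open>m\<close> is the mean of the number \<open>F\<close> of free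
    vertices, and \<open>m0\<close> bounds it from below.\<close>
  define q where "q v = 1 / (1 + lam) ^ card (nb v \<inter> D)" for v
  define m where "m = (\<Sum>v\<in>X. q v)"
  define F where "F B = (\<Sum>v\<in>X. of_bool (nb v \<inter> B = {}) :: real)" for B
  have T: "0 < T" using lam by (simp add: T_def)
  have q: "0 \<le> q v" "q v \<le> 1" for v using lam by (auto simp: q_def field_simps)
  have m0: "0 < m0" using lam X finX by (simp add: m0_def card_gt_0_iff)
  have "m0 \<le> m"
  proof -
    have "m0 = (\<Sum>v\<in>X. 1 / (1 + lam) ^ d)" by (simp add: m0_def)
    also have "\<dots> \<le> m" unfolding m_def q_def
    proof (rule sum_mono)
      fix v assume v: "v \<in> X"
      have "card (nb v \<inter> D) \<le> d" using card_mono[OF fin_nb, of v "nb v \<inter> D"] deg v by auto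
      then show "1 / (1 + lam) ^ d \<le> 1 / (1 + lam) ^ card (nb v \<inter> D)"
        using lam by (intro divide_left_mono power_increasing) auto
    qed
    finally show ?thesis .
  qed
  have Feq: "real (card (X - NB B)) = F B" for B
  proof -
    have "{v \<in> X. nb v \<inter> B = {}} = X - NB B" using nb_sym by (auto simp: NB_def)
    then show ?thesis using finX unfolding F_def
      by (simp add: of_bool_def sum.If_cases Int_def)
  qed
  have EF: "(\<Sum>B\<in>Pow D. lam ^ card B * F B) = T * m"
  proof -
    have "(\<Sum>B\<in>Pow D. lam ^ card B * F B) = (\<Sum>v\<in>X. \<Sum>B\<in>Pow D. lam ^ card B * of_bool (nb v \<inter> B = {}))"
      unfolding F_def sum_distrib_left by (rule sum.swap)
    also have "\<dots> = (\<Sum>v\<in>X. T * q v)"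
      unfolding sum_avoiding[OF lam finD] T_def q_def by simp
    finally show ?thesis by (simp add: m_def sum_distrib_left)
  qed
  \<comment> \<open>Pairs without common neighbour are independent; each \<open>v\<close> has at
    most \<open>d ^ 2\<close> other partners, which add at most \<open>d ^ 2 * m\<close> to the
    second moment.\<close>
  have pair: "1 / (1 + lam) ^ card ((nb v \<union> nb w) \<inter> D) \<le> q v * q w + of_bool (linked2 v w) * q v"
    if "v \<in> X" "w \<in> X" for v w
  proof (cases "linked2 v w")
    case True
    have "card (nb v \<inter> D) \<le> card ((nb v \<union> nb w) \<inter> D)" using finD by (intro card_mono) auto
    then have "1 / (1 + lam) ^ card ((nb v \<union> nb w) \<inter> D) \<le> q v"
      unfolding q_def using lam by (intro divide_left_mono power_increasing) auto
    then show ?thesis using True q[of v] q[of w] by (simp add: add_increasing)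
  next
    case False
    then have "(nb v \<inter> D) \<inter> (nb w \<inter> D) = {}" by (auto simp: linked2_def)
    then have "card ((nb v \<union> nb w) \<inter> D) = card (nb v \<inter> D) + card (nb w \<inter> D)"
      using finD by (simp add: Int_Un_distrib2 card_Un_disjoint)
    then show ?thesis using False by (simp add: q_def power_add)
  qed
  have "(\<Sum>B\<in>Pow D. lam ^ card B * (F B)\<^sup>2)
      = (\<Sum>v\<in>X. \<Sum>w\<in>X. \<Sum>B\<in>Pow D. lam ^ card B * of_bool ((nb v \<union> nb w) \<inter> B = {}))"
  proof -
    have "(F B)\<^sup>2 = (\<Sum>v\<in>X. \<Sum>w\<in>X. of_bool ((nb v \<union> nb w) \<inter> B = {}))" for B
      unfolding F_def power2_eq_square sum_product
      by (intro sum.cong refl) (auto simp: Int_Un_distrib2)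
    then have "(\<Sum>B\<in>Pow D. lam ^ card B * (F B)\<^sup>2)
        = (\<Sum>B\<in>Pow D. \<Sum>v\<in>X. \<Sum>w\<in>X. lam ^ card B * of_bool ((nb v \<union> nb w) \<inter> B = {}))"
      by (simp only: sum_distrib_left)
    also have "\<dots> = (\<Sum>v\<in>X. \<Sum>B\<in>Pow D. \<Sum>w\<in>X. lam ^ card B * of_bool ((nb v \<union> nb w) \<inter> B = {}))"
      by (rule sum.swap)
    also have "\<dots> = (\<Sum>v\<in>X. \<Sum>w\<in>X. \<Sum>B\<in>Pow D. lam ^ card B * of_bool ((nb v \<union> nb w) \<inter> B = {}))"
      by (intro sum.cong refl sum.swap)
    finally show ?thesis .
  qed
  also have "\<dots> = T * (\<Sum>v\<in>X. \<Sum>w\<in>X. 1 / (1 + lam) ^ card ((nb v \<union> nb w) \<inter> D))"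
    unfolding sum_avoiding[OF lam finD] sum_distrib_left T_def by simp
  also have "\<dots> \<le> T * (\<Sum>v\<in>X. \<Sum>w\<in>X. q v * q w + of_bool (linked2 v w) * q v)"
    using T pair by (intro mult_left_mono sum_mono) auto
  also have "\<dots> \<le> T * (m\<^sup>2 + d ^ 2 * m)"
  proof -
    have "(\<Sum>v\<in>X. \<Sum>w\<in>X. of_bool (linked2 v w) * q v) = (\<Sum>v\<in>X. card {w\<in>X. linked2 v w} * q v)"
      using finX by (simp add: of_bool_def sum.If_cases Int_def flip: sum_distrib_right)
    also have "\<dots> \<le> (\<Sum>v\<in>X. real d ^ 2 * q v)"
      using q card_linked2 by (intro sum_mono mult_right_mono) (auto simp flip: of_nat_power)
    finally have "(\<Sum>v\<in>X. \<Sum>w\<in>X. of_bool (linked2 v w) * q v) \<le> d ^ 2 * m"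
      by (simp add: m_def sum_distrib_left)
    moreover have "(\<Sum>v\<in>X. \<Sum>w\<in>X. q v * q w) = m\<^sup>2"
      by (simp add: m_def power2_eq_square sum_product)
    ultimately show ?thesis using T by (simp add: sum.distrib)
  qed
  finally have EF2: "(\<Sum>B\<in>Pow D. lam ^ card B * (F B)\<^sup>2) \<le> T * (m\<^sup>2 + d ^ 2 * m)" .
  \<comment> \<open>Since \<open>m0 \<le> m\<close>, falling below \<open>m0 / 2\<close> is a
    deviation of at least \<open>m / 2\<close> from the mean.\<close>
  have "(\<Sum>B\<in>Pow D. lam ^ card B * of_bool (card (X - NB B) < m0 / 2)) * (m / 2)\<^sup>2
      \<le> (\<Sum>B\<in>Pow D. lam ^ card B * (F B - m)\<^sup>2)"
    unfolding sum_distrib_right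
  proof (rule sum_mono)
    fix B
    show "lam ^ card B * of_bool (card (X - NB B) < m0 / 2) * (m / 2)\<^sup>2 \<le> lam ^ card B * (F B - m)\<^sup>2"
    proof (cases "card (X - NB B) < m0 / 2")
      case True
      then have "m / 2 \<le> m - F B" using \<open>m0 \<le> m\<close> Feq[of B] by simp
      then have "(m / 2)\<^sup>2 \<le> (m - F B)\<^sup>2" using m0 \<open>m0 \<le> m\<close> by (intro power_mono) auto
      then show ?thesis using True lam by (simp add: power2_commute)
    qed (use lam in simp)
  qed
  also have "\<dots> = (\<Sum>B\<in>Pow D. lam ^ card B * (F B)\<^sup>2) - 2 * m * (\<Sum>B\<in>Pow D. lam ^ card B * F B)
      + m\<^sup>2 * (\<Sum>B\<in>Pow D. lam ^ card B)"
    unfolding sum_distrib_left sum_subtractf[symmetric] sum.distrib[symmetric]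
    by (intro sum.cong refl) (simp add: power2_diff algebra_simps)
  also have "\<dots> \<le> T * (d ^ 2 * m)"
    using EF2 unfolding EF sum_Pow_power_card[OF finD] T_def[symmetric]
    by (simp add: algebra_simps power2_eq_square)
  finally have "(\<Sum>B\<in>Pow D. lam ^ card B * of_bool (card (X - NB B) < m0 / 2)) \<le> T * (d ^ 2 * m) / (m / 2)\<^sup>2"
    using m0 \<open>m0 \<le> m\<close> by (simp add: pos_le_divide_eq)
  also have "\<dots> = 4 * d ^ 2 / m * T"
    using m0 \<open>m0 \<le> m\<close> by (simp add: power2_eq_square field_simps)
  also have "\<dots> \<le> 4 * d ^ 2 / m0 * T"
    using T m0 \<open>m0 \<le> m\<close> by (intro mult_right_mono divide_left_mono) auto
  finally show ?thesis by (simp add: T_def)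
qed

text \<open>Exponential tilting: halving \<open>lam\<close> costs a factor \<open>2 ^ card A\<close>
  but shrinks the partition function by \<open>rho ^ card U\<close>. The constant \<open>c\<close>
  is chosen so that the cost uses up exactly half of the gain in the exponent.\<close>

lemma few_chosen_le:
  fixes lam rho c :: real
  assumes lam: "0 < lam" and "finite U"
  defines "rho \<equiv> (1 + lam / 2) / (1 + lam)"
  defines "c \<equiv> - log 2 rho / 2"
  shows "(\<Sum>A\<in>Pow U. lam ^ card A * of_bool (card A \<le> c * card U))
    \<le> rho powr (card U / 2) * (1 + lam) ^ card U"
proof -
  let ?n = "card U"
  have rho: "0 < rho" using lam by (simp add: rho_def)
  have "(\<Sum>A\<in>Pow U. lam ^ card A * of_bool (card A \<le> c * ?n))
      \<le> (\<Sum>A\<in>Pow U. 2 powr (c * ?n) * (lam / 2) ^ card A)"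
  proof (rule sum_mono)
    fix A
    show "lam ^ card A * of_bool (card A \<le> c * ?n) \<le> 2 powr (c * ?n) * (lam / 2) ^ card A"
    proof (cases "card A \<le> c * ?n")
      case True
      then have "2 powr real (card A) \<le> 2 powr (c * ?n)" by (intro powr_mono) auto
      then have "2 ^ card A * (lam / 2) ^ card A \<le> 2 powr (c * ?n) * (lam / 2) ^ card A"
        using lam by (intro mult_right_mono) (auto simp: powr_realpow)
      then show ?thesis using True by (simp add: power_divide)
    qed (use lam in simp)
  qed
  also have "\<dots> = 2 powr (c * ?n) * (1 + lam / 2) ^ ?n"
    using assms(2) by (simp add: sum_Pow_power_card flip: sum_distrib_left)
  also have "(1 + lam / 2) ^ ?n = rho powr ?n * (1 + lam) ^ ?n"
    using lam rho by (simp add: powr_realpow power_divide rho_def)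
  also have "2 powr (c * ?n) = rho powr (- (?n / 2))"
  proof -
    have "2 powr (c * ?n) = (2 powr (log 2 rho)) powr (- (?n / 2))"
      by (simp add: powr_powr c_def)
    then show ?thesis using rho by simp
  qed
  finally show ?thesis by (simp add: mult.assoc[symmetric] flip: powr_add)
qed

end

lemma (in bireg) lower_tail:
  fixes lam m0 rho c :: real
  assumes lam: "0 < lam" and X: "X \<noteq> {}"
  defines "m0 \<equiv> card X / (1 + lam) ^ d" and "rho \<equiv> (1 + lam / 2) / (1 + lam)"
  defines "c \<equiv> - log 2 rho / 2"
  shows "weight lam (\<lambda>I. card (I \<inter> X) \<le> c * (m0 / 2)) \<le> (4 * d ^ 2 / m0 + rho powr (m0 / 4)) * total lam"
proof -
  interpret D: bireg Y X nb d by (rule dual)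
  have DW: "D.weight lam P = weight lam P" for P
    by (simp add: D.weight_def weight_def D.indeps_def indeps_def Un_commute)
  have rho: "0 < rho" "rho < 1" using lam by (auto simp: rho_def)
  then have c: "0 < c" by (simp add: c_def)
  have "weight lam (\<lambda>I. card (I \<inter> X) \<le> c * (m0 / 2))
    \<le> weight lam (\<lambda>I. card (X - NB (I \<inter> Y)) < m0 / 2 \<or>
        card (I \<inter> X) \<le> c * card (X - NB (I \<inter> Y)) \<and> m0 / 2 \<le> card (X - NB (I \<inter> Y)))"
  proof (rule weight_mono)
    fix I assume I: "card (I \<inter> X) \<le> c * (m0 / 2)"
    have "c * (m0 / 2) \<le> c * card (X - NB (I \<inter> Y))" if "m0 / 2 \<le> card (X - NB (I \<inter> Y))"
      using that c by (intro mult_left_mono) auto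
    then show "card (X - NB (I \<inter> Y)) < m0 / 2 \<or>
        card (I \<inter> X) \<le> c * card (X - NB (I \<inter> Y)) \<and> m0 / 2 \<le> card (X - NB (I \<inter> Y))"
      using I by linarith
  qed (use lam in simp)
  also have "\<dots> \<le> weight lam (\<lambda>I. card (X - NB (I \<inter> Y)) < m0 / 2)
      + weight lam (\<lambda>I. card (I \<inter> X) \<le> c * card (X - NB (I \<inter> Y)) \<and> m0 / 2 \<le> card (X - NB (I \<inter> Y)))"
    using lam by (intro weight_disj) auto
  also have "weight lam (\<lambda>I. card (X - NB (I \<inter> Y)) < m0 / 2) \<le> 4 * d ^ 2 / m0 * total lam"
    unfolding m0_def
    by (rule weight_conditional_le[OF lam, of "\<lambda>A B. card (X - NB B) < card X / (1 + lam) ^ d / 2"])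
      (rule few_free_le[OF lam _ X], blast)
  \<comment> \<open>Here the part in \<open>Y\<close> is fixed instead, hence the dual locale; at
    least \<open>m0 / 2\<close> free vertices turn \<open>rho powr (card ?U / 2)\<close> into
    \<open>rho powr (m0 / 4)\<close>.\<close>
  also have "weight lam (\<lambda>I. card (I \<inter> X) \<le> c * card (X - NB (I \<inter> Y)) \<and> m0 / 2 \<le> card (X - NB (I \<inter> Y)))
      \<le> rho powr (m0 / 4) * total lam"
    unfolding DW[symmetric]
  proof (rule D.weight_conditional_le[OF lam,
        of "\<lambda>B A. card A \<le> c * card (X - NB B) \<and> m0 / 2 \<le> card (X - NB B)"])
    fix B assume "B \<subseteq> Y"
    let ?U = "X - NB B"
    show "(\<Sum>A\<in>Pow ?U. lam ^ card A * of_bool (card A \<le> c * card ?U \<and> m0 / 2 \<le> card ?U))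
        \<le> rho powr (m0 / 4) * (1 + lam) ^ card ?U"
    proof (cases "m0 / 2 \<le> card ?U")
      case True
      have "(\<Sum>A\<in>Pow ?U. lam ^ card A * of_bool (card A \<le> c * card ?U))
          \<le> rho powr (card ?U / 2) * (1 + lam) ^ card ?U"
        unfolding c_def rho_def using finX by (intro few_chosen_le[OF lam]) auto
      also have "\<dots> \<le> rho powr (m0 / 4) * (1 + lam) ^ card ?U"
        using True rho lam by (intro mult_right_mono powr_mono') auto
      finally show ?thesis using True by simp
    qed (use lam in simp)
  qed
  finally show ?thesis by (simp add: distrib_right)
qed

section \<open>The upper tail\<close>

context iso_bireg
begin

text \<open>Outside three unlikely events there are fewer than \<open>exp 2 * m0\<close> isolated
  vertices in \<open>I \<inter> X\<close>, no component has \<open>d / 2\<close> or more vertices,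
  and the remaining components together have fewer than \<open>m0\<close> vertices.\<close>

lemma upper_tail:
  fixes lam eta m0 r :: real
  assumes lam: "0 < lam" "lam < 1" and X: "X \<noteq> {}" and eta: "0 < eta" "eta \<le> 1"
    and c1: "48 * ln d / (eta * d) + 4 / d \<le> ln (1 + lam) * eta / (12 * sqrt d)"
    and c2: "2 * eta * ln d + ln (1 + lam) * eta / 2 \<le> ln (1 + lam)"
  defines "m0 \<equiv> card X / (1 + lam) ^ d"
    and "r \<equiv> 2 * real d ^ 4 * (1 + lam) powr (- (real d / 4))"
  assumes r: "r \<le> 1"
  shows "weight lam (\<lambda>I. 2 * card (cl (I \<inter> X)) \<le> card X \<and> (exp 2 + 1) * m0 + 1 \<le> card (I \<inter> X))
    \<le> (exp (- m0) + 2 * (real (card X) + 1) ^ 3 * exp (- (ln (1 + lam) / 48 * eta * (real d ^ 2 / sqrt d)))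
        + d * r ^ 2) * total lam"
proof -
  define K where "K = nat \<lceil>exp 2 * m0\<rceil>"
  \<comment> \<open>The condition on \<open>NB T\<close> encodes that the \<open>K\<close> vertices
    have pairwise disjoint neighbourhoods.\<close>
  define \<T> where "\<T> = {T. T \<subseteq> X \<and> card T = K \<and> card (NB T) = d * K}"
  define \<B> where "\<B> = {S. S \<subseteq> X \<and> conn linked2 S \<and> d \<le> 2 * card S \<and> 2 * card (cl S) \<le> card X}"
  define \<M> where "\<M> = {S. S \<subseteq> X \<and> conn linked2 S \<and> 2 \<le> card S \<and> 2 * card S < d}"
  define med where "med I \<longleftrightarrow> m0 \<le> (\<Sum>S\<in>\<M>. real (card S) * of_bool (sep S I))" for I
  have fin: "finite \<T>" "finite \<B>" "finite \<M>" using finX by (auto simp: \<T>_def \<B>_def \<M>_def)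
  have m0: "0 < m0" using lam X finX by (simp add: m0_def card_gt_0_iff)
  have K: "exp 2 * m0 \<le> K" "K < exp 2 * m0 + 1" using m0 by (auto simp: K_def) linarith+
  have Z0: "0 \<le> total lam" using lam by (intro weight_nonneg) auto
  let ?w = "\<lambda>S. lam ^ card S / (1 + lam) ^ card (NB S)"

  have WT: "weight lam (\<lambda>I. \<exists>S\<in>\<T>. sep S I) \<le> exp (- m0) * total lam"
  proof -
    \<comment> \<open>With this weight all subsets of \<open>X\<close> together weigh at most
      \<open>exp (exp 2 * m0)\<close>. Multiplying the resulting count by the weight of one
      \<open>T\<close> leaves \<open>exp (exp 2 * m0 - 2 * K)\<close>, and
      \<open>K \<ge> exp 2 * m0\<close>.\<close>
    let ?x = "exp 2 / (1 + lam) ^ d"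
    have x: "0 < ?x" using lam by simp
    have "card \<T> * ?x ^ K = (\<Sum>T\<in>\<T>. ?x ^ card T)" by (simp add: \<T>_def)
    also have "\<dots> \<le> (\<Sum>T\<in>Pow X. ?x ^ card T)"
      using finX x by (intro sum_mono2) (auto simp: \<T>_def)
    also have "\<dots> = (1 + ?x) ^ card X" using finX by (simp add: sum_Pow_power_card)
    also have "\<dots> \<le> exp ?x ^ card X" using x by (intro power_mono) auto
    also have "\<dots> = exp (exp 2 * m0)" by (simp add: m0_def mult_ac flip: exp_of_nat_mult)
    finally have cT: "card \<T> \<le> exp (exp 2 * m0) / ?x ^ K" using x by (simp add: pos_le_divide_eq)
    have "weight lam (\<lambda>I. \<exists>S\<in>\<T>. sep S I) \<le> (\<Sum>S\<in>\<T>. weight lam (sep S))"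
      using lam fin by (intro weight_Bex) auto
    also have "\<dots> \<le> (\<Sum>S\<in>\<T>. (lam / (1 + lam) ^ d) ^ K * total lam)"
    proof (rule sum_mono)
      fix S assume "S \<in> \<T>"
      then show "weight lam (sep S) \<le> (lam / (1 + lam) ^ d) ^ K * total lam"
        using weight_sep_le[OF lam(1), of S] by (simp add: \<T>_def power_divide power_mult)
    qed
    also have "\<dots> = card \<T> * (lam / (1 + lam) ^ d) ^ K * total lam" by simp
    also have "\<dots> \<le> (exp (exp 2 * m0) / ?x ^ K) * (lam / (1 + lam) ^ d) ^ K * total lam"
      using cT Z0 lam by (intro mult_right_mono) auto
    also have "\<dots> = exp (exp 2 * m0) * exp (- (2 * K)) * lam ^ K * total lam"
    proof -
      have "exp (2::real) ^ K = exp (2 * K)" by (simp add: mult.commute flip: exp_of_nat_mult)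
      then show ?thesis using lam by (simp add: power_divide exp_minus field_simps)
    qed
    also have "\<dots> \<le> exp (exp 2 * m0) * exp (- (2 * K)) * 1 * total lam"
      using Z0 lam by (intro mult_right_mono mult_left_mono power_le_one) auto
    also have "\<dots> \<le> exp (- m0) * total lam"
    proof -
      have "1 * m0 \<le> exp 2 * m0" using m0 by (intro mult_right_mono) auto
      then have "exp 2 * m0 + - (2 * K) \<le> - m0" using K by linarith
      then show ?thesis using Z0 by (intro mult_right_mono) (auto simp flip: exp_add)
    qed
    finally show ?thesis .
  qed

  have WB: "weight lam (\<lambda>I. \<exists>S\<in>\<B>. sep S I)
      \<le> 2 * (real (card X) + 1) ^ 3 * exp (- (ln (1 + lam) / 48 * eta * (real d ^ 2 / sqrt d))) * total lam"
  proof -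
    have "weight lam (\<lambda>I. \<exists>S\<in>\<B>. sep S I) \<le> (\<Sum>S\<in>\<B>. weight lam (sep S))"
      using lam fin by (intro weight_Bex) auto
    also have "\<dots> \<le> (\<Sum>S\<in>\<B>. ?w S * total lam)"
      using weight_sep_le[OF lam(1)] by (intro sum_mono) (auto simp: \<B>_def)
    also have "\<dots> = (\<Sum>S\<in>\<B>. ?w S) * total lam" by (simp add: sum_distrib_right)
    also have "\<dots> \<le> 2 * (real (card X) + 1) ^ 3 * exp (- (ln (1 + lam) / 48 * eta * (real d ^ 2 / sqrt d))) * total lam"
      unfolding \<B>_def using big_sum[OF lam(1) eta c1 c2] Z0 by (rule mult_right_mono)
    finally show ?thesis .
  qed

  have WM: "weight lam med \<le> d * r ^ 2 * total lam"
  proof -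
    \<comment> \<open>Markov's inequality for the total size of the medium separated pieces.\<close>
    have "m0 * weight lam med \<le> (\<Sum>I\<in>indeps. lam ^ card I * (\<Sum>S\<in>\<M>. real (card S) * of_bool (sep S I)))"
      unfolding weight_eq_sum_of_bool sum_distrib_left
    proof (rule sum_mono)
      fix I
      have "m0 * of_bool (med I) \<le> (\<Sum>S\<in>\<M>. real (card S) * of_bool (sep S I))"
        by (cases "med I") (auto simp: med_def intro: sum_nonneg)
      then have "lam ^ card I * (m0 * of_bool (med I)) \<le> lam ^ card I * (\<Sum>S\<in>\<M>. real (card S) * of_bool (sep S I))"
        using lam by (intro mult_left_mono) auto
      then show "m0 * (lam ^ card I * of_bool (med I)) \<le> (\<Sum>S\<in>\<M>. lam ^ card I * (real (card S) * of_bool (sep S I)))"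
        unfolding sum_distrib_left by (simp only: mult.left_commute)
    qed
    also have "\<dots> = (\<Sum>S\<in>\<M>. card S * weight lam (sep S))"
      unfolding weight_eq_sum_of_bool sum_distrib_left by (subst sum.swap) (simp add: mult_ac)
    also have "\<dots> \<le> (\<Sum>S\<in>\<M>. card S * (?w S * total lam))"
      using weight_sep_le[OF lam(1)] by (intro sum_mono mult_left_mono) (auto simp: \<M>_def)
    also have "\<dots> = (\<Sum>S\<in>\<M>. card S * ?w S) * total lam"
      unfolding sum_distrib_right by (simp only: mult.assoc)
    also have "\<dots> \<le> m0 * (d * r ^ 2) * total lam"
      unfolding \<M>_def m0_def r_def using lam r Z0
      by (intro mult_right_mono small_sum) (auto simp: r_def)
    finally show ?thesis using m0 by (simp add: mult.assoc)
  qed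

  have "weight lam (\<lambda>I. 2 * card (cl (I \<inter> X)) \<le> card X \<and> (exp 2 + 1) * m0 + 1 \<le> card (I \<inter> X))
    \<le> weight lam (\<lambda>I. (\<exists>S\<in>\<T>. sep S I) \<or> (\<exists>S\<in>\<B>. sep S I) \<or> med I)"
  proof (rule weight_mono)
    fix I assume I: "I \<in> indeps" "2 * card (cl (I \<inter> X)) \<le> card X \<and> (exp 2 + 1) * m0 + 1 \<le> card (I \<inter> X)"
    let ?A = "I \<inter> X"
    \<comment> \<open>\<open>J\<close> consists of the isolated vertices; \<open>K\<close> of them
      would form a separated set in \<open>\<T>\<close>.\<close>
    define J where "J = {v\<in>?A. nb v \<inter> NB (?A - {v}) = {}}"
    have finA: "finite ?A" "J \<subseteq> ?A" using finX by (auto simp: J_def)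
    show "(\<exists>S\<in>\<T>. sep S I) \<or> (\<exists>S\<in>\<B>. sep S I) \<or> med I"
    proof (rule ccontr)
      assume neg: "\<not> ((\<exists>S\<in>\<T>. sep S I) \<or> (\<exists>S\<in>\<B>. sep S I) \<or> med I)"
      have "card J < K"
      proof (rule ccontr)
        assume "\<not> card J < K"
        then obtain T where T: "T \<subseteq> J" "card T = K"
          using obtain_subset_with_card_n[of K J] by auto
        have disj: "nb v \<inter> nb w = {}" if "v \<in> T" "w \<in> ?A" "v \<noteq> w" for v w
          using that T by (auto simp: J_def NB_def)
        have TX: "T \<subseteq> X" using T finA by blast
        have "\<forall>v\<in>T. \<forall>w\<in>T. v \<noteq> w \<longrightarrow> nb v \<inter> nb w = {}" using disj T(1) finA(2) by blast
        then have "card (NB T) = (\<Sum>v\<in>T. card (nb v))" unfolding NB_def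
          using finite_sub_X[OF TX] TX fin_nb by (intro card_UN_disjoint) auto
        also have "\<dots> = d * K" using TX T deg by (simp add: subset_iff)
        finally have "T \<in> \<T>" using T TX by (simp add: \<T>_def)
        moreover have "sep T I" using T finA disj by (fastforce simp: sep_def NB_def)
        ultimately show False using neg by blast
      qed
      then have cJ: "card J < exp 2 * m0" unfolding K_def by linarith
      \<comment> \<open>The component of any other vertex has at least two elements, and it cannot
        be large because its closure lies in \<open>cl ?A\<close>, which is at most half of
        \<open>X\<close>; so it is medium.\<close>
      have sub: "?A - J \<subseteq> (\<Union>S\<in>{S\<in>\<M>. sep S I}. S)"
      proof
        fix v assume v: "v \<in> ?A - J"
        obtain S where S: "conn linked2 S" "v \<in> S" "S \<subseteq> ?A" "\<forall>x\<in>S. \<forall>y\<in>?A - S. \<not> linked2 x y"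
          using conn_component[OF finA(1), of v linked2] v by blast
        have sepS: "sep S I" using S by (auto simp: sep_def NB_def linked2_def)
        have "S \<noteq> {v}" using S v by (auto simp: J_def NB_def linked2_def)
        then have "\<exists>w. w \<in> S \<and> w \<noteq> v" using S(2) by blast
        then obtain w where w: "w \<in> S" "w \<noteq> v" by blast
        have "card {v, w} \<le> card S"
          using conn_finite[OF S(1)] S(2) w(1) by (intro card_mono) auto
        then have "2 \<le> card S" using w by simp
        moreover have "2 * card S < d"
        proof (rule ccontr)
          assume "\<not> 2 * card S < d"
          moreover have "card (cl S) \<le> card (cl ?A)"
            using finite_sub_X[OF cl_subset] cl_mono[OF S(3)] by (intro card_mono)
          ultimately have "S \<in> \<B>" using S I(2) by (auto simp: \<B>_def)
          then show False using neg sepS by blast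
        qed
        ultimately have "S \<in> \<M>" using S by (auto simp: \<M>_def)
        then show "v \<in> (\<Union>S\<in>{S\<in>\<M>. sep S I}. S)" using S sepS by blast
      qed
      have "card (?A - J) \<le> card (\<Union>S\<in>{S\<in>\<M>. sep S I}. S)"
        using sub fin finX by (intro card_mono) (auto simp: \<M>_def intro: finite_subset)
      also have "\<dots> \<le> (\<Sum>S\<in>{S\<in>\<M>. sep S I}. card S)"
        using fin by (intro card_UN_le) auto
      finally have "real (card (?A - J)) \<le> (\<Sum>S\<in>{S\<in>\<M>. sep S I}. real (card S))"
        unfolding of_nat_sum[symmetric] by (rule of_nat_mono)
      also have "\<dots> = (\<Sum>S\<in>\<M>. real (card S) * of_bool (sep S I))"
        using fin by (intro sum.mono_neutral_cong_left) auto
      also have "\<dots> < m0" using neg by (simp add: med_def)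
      finally have "card (?A - J) < m0" .
      moreover have "card (?A - J) + card J = card ?A"
        using finA card_Int_plus_Diff[of ?A J] by (simp add: Int_absorb1 add.commute)
      ultimately have "real (card ?A) < (exp 2 + 1) * m0" using cJ by (simp add: algebra_simps)
      then show False using I(2) by linarith
    qed
  qed (use lam in simp)
  also have "\<dots> \<le> weight lam (\<lambda>I. \<exists>S\<in>\<T>. sep S I) + (weight lam (\<lambda>I. \<exists>S\<in>\<B>. sep S I) + weight lam med)"
    using lam weight_disj[of lam "\<lambda>I. \<exists>S\<in>\<T>. sep S I" "\<lambda>I. (\<exists>S\<in>\<B>. sep S I) \<or> med I"]
      weight_disj[of lam "\<lambda>I. \<exists>S\<in>\<B>. sep S I" med] by linarith
  finally show ?thesis using WT WB WM by (simp add: algebra_simps)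
qed

end

section \<open>Both bounds\<close>

context iso_bireg
begin

text \<open>By independence the closure of the part in \<open>Y\<close> avoids
  \<open>NB (I \<inter> X)\<close>, which is at least as large as the closure of the part in
  \<open>X\<close>. Hence one of the two closures fills at most half of its side.\<close>

lemma card_cl_add_le:
  assumes I: "I \<in> indeps"
  shows "card (cl (I \<inter> X)) + card (bireg.cl Y nb (I \<inter> Y)) \<le> card X"
proof -
  interpret D: bireg Y X nb d by (rule dual)
  have "D.cl (I \<inter> Y) \<subseteq> Y - NB (I \<inter> X)"
  proof
    fix u assume u: "u \<in> D.cl (I \<inter> Y)"
    have False if "u \<in> NB (I \<inter> X)"
    proof -
      obtain v where v: "v \<in> I" "v \<in> nb u" using \<open>u \<in> NB (I \<inter> X)\<close> nb_sym by (auto simp: NB_def)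
      then obtain w where "w \<in> I" "v \<in> nb w" using u by (auto simp: D.cl_def NB_def)
      then show False using I v by (auto simp: indeps_def)
    qed
    then show "u \<in> Y - NB (I \<inter> X)" using u by (auto simp: D.cl_def)
  qed
  then have "card (D.cl (I \<inter> Y)) \<le> card (Y - NB (I \<inter> X))" using finY by (intro card_mono) auto
  moreover have "card (Y - NB (I \<inter> X)) + card (NB (I \<inter> X)) = card X"
    using NB_X[of "I \<inter> X"] finY card_Int_plus_Diff[of Y "NB (I \<inter> X)"] card_eq
    by (simp add: Int_absorb1 add.commute)
  moreover have "card (cl (I \<inter> X)) \<le> card (NB (I \<inter> X))"
    using card_le_card_NB[OF cl_subset, of "I \<inter> X"] NB_cl[of "I \<inter> X"] by simp
  ultimately show ?thesis by linarith
qed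

text \<open>If the minimum is too large, both parts are, and \<open>upper_tail\<close> applies to
  the side whose closure is at most half. The dual is assumed because \<open>iso_bireg\<close> is
  not symmetric.\<close>

lemma two_sided:
  fixes lam eta m0 r rho c :: real
  assumes dual': "iso_bireg Y X nb d"
    and lam: "0 < lam" "lam < 1" and X: "X \<noteq> {}" and eta: "0 < eta" "eta \<le> 1"
    and c1: "48 * ln d / (eta * d) + 4 / d \<le> ln (1 + lam) * eta / (12 * sqrt d)"
    and c2: "2 * eta * ln d + ln (1 + lam) * eta / 2 \<le> ln (1 + lam)"
  defines "m0 \<equiv> card X / (1 + lam) ^ d"
    and "r \<equiv> 2 * real d ^ 4 * (1 + lam) powr (- (real d / 4))"
    and "rho \<equiv> (1 + lam / 2) / (1 + lam)" and "c \<equiv> - log 2 rho / 2"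
  assumes r: "r \<le> 1"
  shows "weight lam (\<lambda>I. \<not> (c * (m0 / 2) \<le> min (card (I \<inter> X)) (card (I \<inter> Y))
      \<and> min (card (I \<inter> X)) (card (I \<inter> Y)) \<le> (exp 2 + 1) * m0 + 1))
    \<le> 2 * ((4 * d ^ 2 / m0 + rho powr (m0 / 4)) + (exp (- m0)
        + 2 * (real (card X) + 1) ^ 3 * exp (- (ln (1 + lam) / 48 * eta * (real d ^ 2 / sqrt d)))
        + d * r ^ 2)) * total lam"
proof -
  interpret D: iso_bireg Y X nb d by (rule dual')
  have DW: "D.weight lam P = weight lam P" for P
    by (simp add: D.weight_def weight_def D.indeps_def indeps_def Un_commute)
  have Y: "Y \<noteq> {}" using X card_eq finX by auto
  let ?h = "(exp 2 + 1) * m0 + 1"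
  let ?P1 = "\<lambda>I. card (I \<inter> X) \<le> c * (m0 / 2)" and ?P2 = "\<lambda>I. card (I \<inter> Y) \<le> c * (m0 / 2)"
  let ?P3 = "\<lambda>I. 2 * card (cl (I \<inter> X)) \<le> card X \<and> ?h \<le> card (I \<inter> X)"
  let ?P4 = "\<lambda>I. 2 * card (D.cl (I \<inter> Y)) \<le> card Y \<and> ?h \<le> card (I \<inter> Y)"
  have "weight lam (\<lambda>I. \<not> (c * (m0 / 2) \<le> min (card (I \<inter> X)) (card (I \<inter> Y))
      \<and> min (card (I \<inter> X)) (card (I \<inter> Y)) \<le> ?h)) \<le> weight lam (\<lambda>I. ?P1 I \<or> ?P2 I \<or> ?P3 I \<or> ?P4 I)"
  proof (rule weight_mono)
    fix I assume I: "I \<in> indeps" and "\<not> (c * (m0 / 2) \<le> min (card (I \<inter> X)) (card (I \<inter> Y))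
      \<and> min (card (I \<inter> X)) (card (I \<inter> Y)) \<le> ?h)"
    then consider "?P1 I" | "?P2 I" | "?h \<le> card (I \<inter> X)" "?h \<le> card (I \<inter> Y)"
      unfolding of_nat_min min_le_iff_disj min.bounded_iff by linarith
    then show "?P1 I \<or> ?P2 I \<or> ?P3 I \<or> ?P4 I"
    proof cases
      case 3
      have "2 * card (cl (I \<inter> X)) \<le> card X \<or> 2 * card (D.cl (I \<inter> Y)) \<le> card Y"
        using card_cl_add_le[OF I] card_eq by linarith
      then show ?thesis using 3 by blast
    qed blast+
  qed (use lam in simp)
  also have "\<dots> \<le> weight lam ?P1 + (weight lam ?P2 + (weight lam ?P3 + weight lam ?P4))"
    using lam weight_disj[of lam ?P1 "\<lambda>I. ?P2 I \<or> ?P3 I \<or> ?P4 I"] weight_disj[of lam ?P2 "\<lambda>I. ?P3 I \<or> ?P4 I"]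
      weight_disj[of lam ?P3 ?P4] by linarith
  also have "\<dots> \<le> 2 * ((4 * d ^ 2 / m0 + rho powr (m0 / 4)) + (exp (- m0)
        + 2 * (real (card X) + 1) ^ 3 * exp (- (ln (1 + lam) / 48 * eta * (real d ^ 2 / sqrt d)))
        + d * r ^ 2)) * total lam"
    using lower_tail[OF lam(1) X, folded rho_def, folded c_def m0_def]
      D.lower_tail[OF lam(1) Y, folded rho_def card_eq, folded c_def m0_def]
      upper_tail[OF lam X eta c1 c2 r[unfolded r_def], folded m0_def r_def]
      D.upper_tail[OF lam Y eta c1 c2 r[unfolded r_def], folded card_eq, folded m0_def r_def]
    unfolding DW card_eq[symmetric] by (simp only: distrib_right mult.assoc mult_2)
  finally show ?thesis .
qed

end

section \<open>The cube as an instance, and the limit\<close>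

lemma cube_iso_bireg: "iso_bireg (cube_par p (Suc n)) (cube_par (\<not> p) (Suc n)) cube_nb (Suc n)"
proof -
  have fin: "finite (cube_par p (Suc n))" for p
    by (rule finite_subset[of _ "{x. length x = Suc n}"]) (auto simp: cube_par_def)
  interpret bireg "cube_par p (Suc n)" "cube_par (\<not> p) (Suc n)" cube_nb "Suc n"
  proof
    show "y \<in> cube_nb x \<longleftrightarrow> x \<in> cube_nb y" for x y by (rule cube_nb_sym)
    show "cube_par p (Suc n) \<inter> cube_par (\<not> p) (Suc n) = {}" by (auto simp: cube_par_def)
    show "cube_nb x \<subseteq> cube_par (\<not> p) (Suc n)" if "x \<in> cube_par p (Suc n)" for x
      using that by (rule cube_nb_par)
    show "cube_nb y \<subseteq> cube_par p (Suc n)" if "y \<in> cube_par (\<not> p) (Suc n)" for y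
      using cube_nb_par[OF that] by simp
    show "card (cube_nb x) = Suc n" if "x \<in> cube_par p (Suc n) \<union> cube_par (\<not> p) (Suc n)" for x
      using that by (auto simp: card_cube_nb cube_par_def)
  qed (simp_all add: fin card_cube_par)
  show ?thesis
  proof
    show "card (cube_nb x \<inter> cube_nb y) \<le> 2" if "x \<noteq> y" for x y
      using that by (rule card_common_cube_nb_le)
    fix S assume S: "S \<subseteq> cube_par p (Suc n)" "2 * card S \<le> card (cube_par p (Suc n))"
    have "real (card S) \<le> 2 * sqrt n * (real (card (NB S)) - real (card S))"
      using cube_expansion[OF S(1)] S(2) by (simp add: card_cube_par NB_def)
    also have "\<dots> \<le> 2 * sqrt (Suc n) * (real (card (NB S)) - real (card S))"
      using card_le_card_NB[OF S(1)] by (intro mult_right_mono) auto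
    finally show "real (card S) \<le> 2 * sqrt (real (Suc n)) * (real (card (NB S)) - real (card S))" .
  qed
qed

theorem corollary1p3:
  fixes lam :: real
  assumes "0 < lam" and "lam < 1"
  shows "\<exists>c>0. \<exists>C>0.
    (\<lambda>d. measure_pmf.prob (cube_hard_core d lam)
       {I. c * (2 / (1 + lam)) ^ d \<le> real (min (card (I \<inter> cube_even d)) (card (I \<inter> cube_odd d)))
         \<and> real (min (card (I \<inter> cube_even d)) (card (I \<inter> cube_odd d))) \<le> C * (2 / (1 + lam)) ^ d})
    \<longlonglongrightarrow> 1"
proof -
  note lam = assms
  define rho where "rho = (1 + lam / 2) / (1 + lam)"
  define c where "c = - log 2 rho / 2"
  define L where "L = ln (1 + lam)"
  define q where "q = 2 / (1 + lam)"
  \<comment> \<open>For natural \<open>d\<close> this is the \<open>m0\<close> of the cube;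
    \<open>m\<close>, \<open>delta\<close> and \<open>large\<close> take real arguments so that
    limits can be computed at real infinity.\<close>
  define m where "m d = q powr d / 2" for d :: real
  \<comment> \<open>The error of \<open>two_sided\<close> with \<open>eta = d powr (-1/8)\<close>:
    \<open>eta\<^sup>2\<close> dominates \<open>ln d / sqrt d\<close>, as \<open>c1\<close>
    requires, \<open>eta * ln d\<close> tends to 0, as \<open>c2\<close> requires, and
    \<open>eta * d ^ 2 / sqrt d\<close> grows faster than \<open>d\<close>, which beats the cube of
    \<open>2 powr (d - 1) + 1\<close>.\<close>
  define delta where "delta d = 2 * ((4 * d ^ 2 / m d + rho powr (m d / 4)) + (exp (- m d)
        + 2 * (2 powr (d - 1) + 1) ^ 3 * exp (- (L / 48 * d powr (-1/8) * (d ^ 2 / sqrt d)))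
        + d * (2 * d ^ 4 * (1 + lam) powr (- (d / 4))) ^ 2))" for d :: real
  let ?c = "c / 4" and ?C = "exp 2 + 2"
  let ?good = "\<lambda>d. {I. ?c * q ^ d \<le> real (min (card (I \<inter> cube_even d)) (card (I \<inter> cube_odd d)))
         \<and> real (min (card (I \<inter> cube_even d)) (card (I \<inter> cube_odd d))) \<le> ?C * q ^ d}"
  have rho: "0 < rho" "rho < 1" using lam by (auto simp: rho_def)
  then have c: "0 < c" by (simp add: c_def)
  have L: "0 < L" using lam by (simp add: L_def)
  \<comment> \<open>Here \<open>lam < 1\<close> makes \<open>m d\<close> tend to infinity.\<close>
  have q: "1 < q" using lam by (simp add: q_def)
  have "(delta \<longlongrightarrow> 2 * ((0 + 0) + (0 + 0 + 0))) at_top"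
  proof -
    have m: "filterlim m at_top at_top" unfolding m_def using q by real_asymp
    have "((\<lambda>m. rho powr (m / 4)) \<longlongrightarrow> 0) at_top" using rho by real_asymp
    note 1 = filterlim_compose[OF this m]
    have "((\<lambda>m::real. exp (- m)) \<longlongrightarrow> 0) at_top" by real_asymp
    note 2 = filterlim_compose[OF this m]
    have 3: "((\<lambda>d. 4 * d ^ 2 / m d) \<longlongrightarrow> 0) at_top" unfolding m_def using q by real_asymp
    have 4: "((\<lambda>d::real. 2 * (2 powr (d - 1) + 1) ^ 3 * exp (- (L / 48 * d powr (-1/8) * (d ^ 2 / sqrt d)))) \<longlongrightarrow> 0) at_top"
      using L by real_asymp
    have 5: "((\<lambda>d::real. d * (2 * d ^ 4 * (1 + lam) powr (- (d / 4)))^2) \<longlongrightarrow> 0) at_top"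
      using lam by real_asymp
    show ?thesis unfolding delta_def by (intro tendsto_intros 1 2 3 4 5)
  qed
  then have delta0: "(\<lambda>n. delta (real n)) \<longlonglongrightarrow> 0"
    using filterlim_compose filterlim_real_sequentially by fastforce
  define large where "large d \<longleftrightarrow> 48 * ln d / (d powr (-1/8) * d) + 4 / d \<le> L * d powr (-1/8) / (12 * sqrt d)
      \<and> 2 * d powr (-1/8) * ln d + L * d powr (-1/8) / 2 \<le> L
      \<and> 2 * d ^ 4 * (1 + lam) powr (- (d / 4)) \<le> 1 \<and> 1 \<le> d" for d :: real
  have "eventually large at_top" unfolding large_def
    by (intro eventually_conj) (use L lam in real_asymp)+
  then have "eventually (\<lambda>d. large (real d)) sequentially"
    by (rule eventually_compose_filterlim[OF _ filterlim_real_sequentially])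
  then have ev: "eventually (\<lambda>d. 1 - delta (real d) \<le> measure_pmf.prob (cube_hard_core d lam) (?good d)) sequentially"
  proof (rule eventually_mono)
    fix d :: nat
    assume "large (real d)"
    then have d: "48 * ln (real d) / (real d powr (-1/8) * d) + 4 / d \<le> L * real d powr (-1/8) / (12 * sqrt d)"
      "2 * real d powr (-1/8) * ln d + L * real d powr (-1/8) / 2 \<le> L"
      "2 * real d ^ 4 * (1 + lam) powr (- (real d / 4)) \<le> 1" "1 \<le> d"
      by (simp_all add: large_def)
    then obtain n where n: "d = Suc n" by (cases d) auto
    let ?E = "cube_par True d" and ?O = "cube_par False d"
    interpret iso_bireg ?E ?O cube_nb d
      using cube_iso_bireg[of True n] by (simp add: n)
    have dual': "iso_bireg ?O ?E cube_nb d"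
      using cube_iso_bireg[of False n] by (simp add: n)
    have cE: "card ?E = 2 ^ n" "real (card ?E) = 2 powr (real d - 1)"
      using card_cube_par[of True n] by (simp_all add: n powr_realpow)
    then have ne: "?E \<noteq> {}" by auto
    have m: "real (card ?E) / (1 + lam) ^ d = m d"
    proof -
      have "real (card ?E) / (1 + lam) ^ d = q ^ d / 2"
        unfolding cE(1) by (simp add: q_def power_divide n)
      then show ?thesis using q by (simp add: m_def powr_realpow)
    qed
    have V: "cube_verts d = ?E \<union> ?O" by (auto simp: cube_verts_def cube_par_def)
    have indeps: "indep_sets_of (cube_verts d) (cube_adj d) = indeps"
    proof -
      have "(\<forall>x\<in>I. \<forall>y\<in>I. \<not> cube_adj d x y) \<longleftrightarrow> (\<forall>x\<in>I. cube_nb x \<inter> I = {})" if "I \<subseteq> cube_verts d" for I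
        using that cube_adj_iff by blast
      then show ?thesis unfolding indep_sets_of_def indeps_def V[symmetric]
        by (intro Collect_cong conj_cong refl)
    qed
    have pmf: "pmf (cube_hard_core d lam) I = (if I \<in> indeps then lam ^ card I / total lam else 0)" for I
      using pmf_hard_core[OF finite_cube_verts lam(1), of d "cube_adj d" I] by (simp add: indeps weight_def)
    have prob: "measure_pmf.prob (cube_hard_core d lam) {I. P I} = weight lam P / total lam" for P
    proof -
      have "measure_pmf.prob (cube_hard_core d lam) {I. P I}
          = measure_pmf.prob (cube_hard_core d lam) {I. I \<in> indeps \<and> P I}"
        by (intro measure_prob_cong_0) (auto simp: pmf)
      also have "\<dots> = weight lam P / total lam"
        by (subst measure_measure_pmf_finite) (simp_all add: pmf weight_def sum_divide_distrib)
      finally show ?thesis .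
    qed
    have "measure_pmf.prob (cube_hard_core d lam) (- ?good d)
      \<le> weight lam (\<lambda>I. \<not> (c * (m d / 2) \<le> min (card (I \<inter> ?E)) (card (I \<inter> ?O))
          \<and> min (card (I \<inter> ?E)) (card (I \<inter> ?O)) \<le> (exp 2 + 1) * m d + 1)) / total lam"
    proof -
      have qd: "q ^ d = 2 * m d" "1 \<le> q ^ d" using q by (simp_all add: m_def powr_realpow one_le_power)
      have "?c * q ^ d = c * (m d / 2)" using qd by simp
      \<comment> \<open>The summand 1 is absorbed since \<open>m d \<ge> 1/2\<close>.\<close>
      moreover have "(exp 2 + 1) * m d + 1 \<le> ?C * q ^ d"
      proof -
        have "?C * q ^ d - ((exp 2 + 1) * m d + 1) = exp 2 * m d + (3 * m d - 1)"
          unfolding qd(1) by (simp add: algebra_simps)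
        moreover have "0 \<le> exp 2 * m d" using qd by simp
        ultimately show ?thesis using qd by linarith
      qed
      ultimately show ?thesis
        unfolding prob[symmetric] cube_even_eq cube_odd_eq
        by (intro measure_pmf.finite_measure_mono) auto
    qed
    also have "\<dots> \<le> delta d * total lam / total lam"
    proof (rule divide_right_mono)
      have eta: "0 < real d powr (-1/8)" "real d powr (-1/8) \<le> 1"
        using d(4) powr_mono[of "-1/8" 0 "real d"] by auto
      show "weight lam (\<lambda>I. \<not> (c * (m d / 2) \<le> min (card (I \<inter> ?E)) (card (I \<inter> ?O))
          \<and> min (card (I \<inter> ?E)) (card (I \<inter> ?O)) \<le> (exp 2 + 1) * m d + 1)) \<le> delta d * total lam"
        using two_sided[OF dual' lam ne eta d(1)[unfolded L_def] d(2)[unfolded L_def] d(3),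
            folded rho_def, folded c_def L_def, unfolded m, unfolded cE(2)]
        unfolding delta_def by (simp only: of_nat_mult of_nat_power of_nat_numeral)
    qed (use weight_nonneg[of lam] lam in simp)
    also have "\<dots> = delta d" using total_pos[OF lam(1)] by simp
    finally show "1 - delta (real d) \<le> measure_pmf.prob (cube_hard_core d lam) (?good d)"
      using measure_pmf.prob_compl[of "?good d" "cube_hard_core d lam"] by (simp add: Compl_eq_Diff_UNIV)
  qed
  have "(\<lambda>d. measure_pmf.prob (cube_hard_core d lam) (?good d)) \<longlonglongrightarrow> 1"
  proof (rule tendsto_sandwich[OF ev])
    show "(\<lambda>d. 1 - delta (real d)) \<longlonglongrightarrow> 1" using tendsto_diff[OF tendsto_const delta0, of 1] by simp
  qed (auto intro!: always_eventually measure_pmf.prob_le_1)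
  then show ?thesis unfolding q_def
    using c by (intro exI[of _ ?c] exI[of _ ?C] conjI) (auto intro: add_pos_pos)
qed

end
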